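(* Let $I$ be a finite set, let $\alpha$ be a composition of $|I|$, and let $\mathcal{O}_\alpha=\mathcal{O}_{\alpha,I}\in\overline{\mathrm{OP}}[I]$. Then the polynomial invariant of $\mathcal{O}_\alpha$ corresponding to the basic character is given by $$\chi_I(\mathcal{O}_\alpha)(t)=\sum_{\gamma\text{ refines }\alpha}\binom{|I|}{\gamma}\binom{t}{\ell(\gamma)},$$ where the sum is over all compositions $\gamma$ of $|I|$ that refine $\alpha$.
   Context: Compositions. A composition of $n$ is a finite sequence of positive integers (parts) with sum $n$; $\ell(\gamma)$ is the number of parts of $\gamma$. For a composition $\gamma=(\gamma_1,\dots,\gamma_k)$ of $n$, $\binom{n}{\gamma}=\binom{n}{\gamma_1,\dots,\gamma_k}$ is the multinomial coefficient. For compositions $\gamma,\alpha$ of $n$, $\gamma$ refines $\alpha$ if $\gamma$ is obtained from $\alpha$ by splitting each part of $\alpha$ (in place) into one or more parts. Orbit polytopes. For a finite set $I$, $\mathbb{R}I$ is the real vector space with basis $\{e_i:i\in I\}$ and $\mathbb{R}^I$ its dual. The symmetric group $\mathfrak{S}_I$ acts by $\sigma(p)_i=p_{\sigma^{-1}(i)}$; the orbit polytope of $p\in\mathbb{R}I$ is $\mathcal{O}(p)=\operatorname{conv}\{\sigma(p):\sigma\in\mathfrak{S}_I\}$. The composition of $p$ is $(\alpha_1,\dots,\alpha_k)$ where $\alpha_j$ is the number of coordinates of $p$ equal to the $j$-th largest distinct coordinate value; the composition of an orbit polytope is that of any of its vertices. For a face $F\le P$, $\mathcal{N}_P(F)$ is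 the cone of $y\in\mathbb{R}^I$ attaining their maximum over $P$ at every point of $F$; $P,Q$ are normally equivalent if their normal fans $\{\mathcal{N}_P(F)\}_{F\le P}$, $\{\mathcal{N}_Q(F)\}_{F\le Q}$ coincide. Orbit polytopes in $\mathbb{R}I$ are normally equivalent iff they have the same composition; $\mathcal{O}_{\alpha,I}$ is the class of those with composition $\alpha$. Hopf structure. For $P\subset\mathbb{R}S$, $Q\subset\mathbb{R}T$, $S\cap T=\varnothing$, $P\cdot Q=\{(p,q):p\in P,q\in Q\}$. $\overline{\mathrm{OP}}[I]$ is the set of normal equivalence classes of finite products of orbit polytopes in $\mathbb{R}I$. For $I=S\sqcup T$ and $P$ such a product, the face of $P$ maximizing $\mathbf{1}_S(x)=\sum_{s\in S}x_s$ is uniquely $P|_S\cdot P/_S$ with $P|_S\subset\mathbb{R}S$, $P/_S\subset\mathbb{R}T$ finite products of orbit polytopes; $\Delta_{S,T}:\overline{\mathrm{OP}}[I]\to\overline{\mathrm{OP}}[S]\times\overline{\mathrm{OP}}[T]$ is induced by $P\mapsto(P|_S,P/_S)$ (well defined on classes). $\Delta_{S_1,\dots,S_k}:\overline{\mathrm{OP}}[I]\to\overline{\mathrm{OP}}[S_1]\times\dots\times\overline{\mathrm{OP}}[S_k]$ is the iterated coproduct (well defined by coassociativity), with $\Delta_{I}=\mathrm{id}$. Basic character and invariant. The basic character $\zeta$ on $\overline{\mathrm{OP}}$, with values in a field $\Bbbk$, is $\zeta_I(x)=1$ if $x$ is the class of a point and $0$ otherwise; on $\mathcal{O}_\alpha$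 it is given by $\zeta_I(\mathcal{O}_\alpha)=1$ if $\alpha$ has only one part and $0$ otherwise. The associated polynomial invariant of $x\in\overline{\mathrm{OP}}[I]$ is $$\chi_I(x)(t)=\sum_{k=1}^{|I|}\Big(\sum_{(S_1,\dots,S_k)\vDash I}(\zeta_{S_1}\otimes\cdots\otimes\zeta_{S_k})\circ\Delta_{S_1,\dots,S_k}(x)\Big)\binom{t}{k},$$ where the inner sum is over ordered partitions of $I$ into $k$ nonempty sets, and $(\zeta_{S_1}\otimes\cdots\otimes\zeta_{S_k})(x_1,\dots,x_k)=\prod_i\zeta_{S_i}(x_i)$.
   Formalization: I is assumed nonempty (for I empty the defining sum over k=1..|I| is 0 while the right-hand side is 1), and the field is assumed of characteristic 0, so that binom(t,k) is defined as a polynomial over it for every k. *)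

theory Defs
  imports "HOL-Analysis.Analysis" "HOL-Computational_Algebra.Polynomial"
begin

text \<open>
  A finite set is given as a subset I of a finite index type. The space
  \<^term>\<open>RI I\<close> is the coordinate subspace spanned by the basis vectors indexed by I.
  The same carrier also represents its dual, a functional y acting on p as the inner
  product, that is, as the sum of y_i p_i over i in I. For disjoint S and T the direct
  sum of the spaces of S and T is the space of their union, so that the pair (p, q)
  is the vector p + q.
\<close>

definition RI :: "'a::finite set \<Rightarrow> (real ^ 'a) set" where
  "RI I = {p. \<forall>i. i \<notin> I \<longrightarrow> p $ i = 0}"

subsection \<open>Compositions\<close>

definition composition_of :: "nat \<Rightarrow> nat list \<Rightarrow> bool" where
  "composition_of n \<gamma> \<longleftrightarrow> (\<forall>x\<in>set \<gamma>. 0 < x) \<and> sum_list \<gamma> = n"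

definition comp_refines :: "nat list \<Rightarrow> nat list \<Rightarrow> bool" where
  "comp_refines \<gamma> \<alpha> \<longleftrightarrow>
     (\<exists>bs :: nat list list. [] \<notin> set bs \<and> map sum_list bs = \<alpha> \<and> concat bs = \<gamma>)"

definition multinomial :: "nat \<Rightarrow> nat list \<Rightarrow> nat" where
  "multinomial n \<gamma> = fact n div (\<Prod>x\<leftarrow>\<gamma>. fact x)"

subsection \<open>Orbit polytopes and their products\<close>

definition perm_act :: "('a \<Rightarrow> 'a) \<Rightarrow> real ^ 'a \<Rightarrow> real ^ ('a::finite)" where
  "perm_act \<sigma> p = (\<chi> i. p $ inv \<sigma> i)"

definition orbit_polytope :: "'a::finite set \<Rightarrow> real ^ 'a \<Rightarrow> (real ^ 'a) set" where
  "orbit_polytope I p = convex hull {perm_act \<sigma> p |\<sigma>. \<sigma> permutes I}"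

definition comp_of_point :: "'a::finite set \<Rightarrow> real ^ 'a \<Rightarrow> nat list" where
  "comp_of_point I p =
     map (\<lambda>v. card {i\<in>I. p $ i = v}) (rev (sorted_list_of_set (($) p ` I)))"

definition pprod :: "(real ^ 'a::finite) set \<Rightarrow> (real ^ 'a) set \<Rightarrow> (real ^ 'a) set" where
  "pprod P Q = {p + q |p q. p \<in> P \<and> q \<in> Q}"

inductive orbit_product :: "'a::finite set \<Rightarrow> (real ^ 'a) set \<Rightarrow> bool" where
  empty: "orbit_product {} {0}"
| mult: "orbit_product S P \<Longrightarrow> S \<inter> T = {} \<Longrightarrow> q \<in> RI T \<Longrightarrow>
    orbit_product (S \<union> T) (pprod P (orbit_polytope T q))"

subsection \<open>Normal equivalence\<close>

definition normal_cone :: "'a::finite set \<Rightarrow> (real ^ 'a) set \<Rightarrow> (real ^ 'a) set \<Rightarrow> (real ^ 'a) set"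
  where "normal_cone I P F = {y\<in>RI I. \<forall>x\<in>F. \<forall>z\<in>P. y \<bullet> z \<le> y \<bullet> x}"

definition normal_fan :: "'a::finite set \<Rightarrow> (real ^ 'a) set \<Rightarrow> (real ^ 'a) set set" where
  "normal_fan I P = {normal_cone I P F |F. F face_of P \<and> F \<noteq> {}}"

definition normal_equiv :: "'a::finite set \<Rightarrow> ((real ^ 'a) set \<times> (real ^ 'a) set) set" where
  "normal_equiv I = {(P, Q). orbit_product I P \<and> orbit_product I Q \<and> normal_fan I P = normal_fan I Q}"

definition OP :: "'a::finite set \<Rightarrow> (real ^ 'a) set set set" where
  "OP I = Collect (orbit_product I) // normal_equiv I"

definition orbit_class :: "'a::finite set \<Rightarrow> nat list \<Rightarrow> (real ^ 'a) set set" where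
  "orbit_class I \<alpha> = normal_equiv I `` {orbit_polytope I p |p. p \<in> RI I \<and> comp_of_point I p = \<alpha>}"

lemma equiv_normal_equiv: "equiv (Collect (orbit_product I)) (normal_equiv I)"
  by (rule equivI) (auto simp: normal_equiv_def refl_on_def sym_def trans_def)

lemma orbit_product_orbit_polytope:
  assumes "p \<in> RI I"
  shows "orbit_product I (orbit_polytope I p)"
  using orbit_product.mult[OF orbit_product.empty, of I p] assms by (simp add: pprod_def)

lemma orbit_polytope_class_in_OP:
  "p \<in> RI I \<Longrightarrow> normal_equiv I `` {orbit_polytope I p} \<in> OP I"
  by (simp add: OP_def quotientI orbit_product_orbit_polytope)

subsection \<open>Coproduct\<close>

definition max_face :: "'a::finite set \<Rightarrow> (real ^ 'a) set \<Rightarrow> (real ^ 'a) set" where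
  "max_face S P = {x\<in>P. \<forall>z\<in>P. (\<Sum>s\<in>S. z $ s) \<le> (\<Sum>s\<in>S. x $ s)}"

definition face_split ::
    "'a::finite set \<Rightarrow> 'a set \<Rightarrow> (real ^ 'a) set \<Rightarrow> (real ^ 'a) set \<times> (real ^ 'a) set" where
  "face_split S T P =
     (THE (A, B). orbit_product S A \<and> orbit_product T B \<and> max_face S P = pprod A B)"

text \<open>The map on classes is the usual lifting of a function that respects the equivalence
  relation: the union over all representatives of the classes of the values.\<close>

definition coproduct ::
    "'a::finite set \<Rightarrow> 'a set \<Rightarrow> (real ^ 'a) set set \<Rightarrow> (real ^ 'a) set set \<times> (real ^ 'a) set set"
  where "coproduct S T X =
     (\<Union>P\<in>X. normal_equiv S `` {fst (face_split S T P)},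
      \<Union>P\<in>X. normal_equiv T `` {snd (face_split S T P)})"

fun iter_coproduct :: "'a::finite set list \<Rightarrow> (real ^ 'a) set set \<Rightarrow> (real ^ 'a) set set list" where
  "iter_coproduct [] X = []"
| "iter_coproduct [S] X = [X]"
| "iter_coproduct (S # S' # Ss) X =
     (let (Y, Z) = coproduct S (\<Union>(set (S' # Ss))) X in Y # iter_coproduct (S' # Ss) Z)"

subsection \<open>Basic character and polynomial invariant\<close>

definition basic_char :: "'a::finite set \<Rightarrow> (real ^ 'a) set set \<Rightarrow> 'k::field" where
  "basic_char I X = (if \<exists>p\<in>RI I. X = normal_equiv I `` {{p}} then 1 else 0)"

definition ordered_partition :: "'a set \<Rightarrow> 'a set list \<Rightarrow> bool" where
  "ordered_partition I Ss \<longleftrightarrow> distinct Ss \<and> partition_on I (set Ss)"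

definition binomial_poly :: "nat \<Rightarrow> 'k::field_char_0 poly" where
  "binomial_poly k = smult (inverse (fact k)) (\<Prod>i<k. [:- of_nat i, 1:])"

lemma poly_binomial_poly: "poly (binomial_poly k) t = t gchoose k"
  by (simp add: binomial_poly_def gbinomial_prod_rev poly_prod atLeast0LessThan divide_inverse_commute)

definition poly_invariant :: "'a::finite set \<Rightarrow> (real ^ 'a) set set \<Rightarrow> 'k::field_char_0 poly" where
  "poly_invariant I X =
     (\<Sum>k=1..card I.
        smult (\<Sum>Ss | ordered_partition I Ss \<and> length Ss = k.
                 prod_list (map2 basic_char Ss (iter_coproduct Ss X)))
              (binomial_poly k))"

end

theory Submission
  imports Defs
begin

text \<open>
  Up to the choice of a point of its orbit, an orbit polytope is cut by a coproduct along
  \<open>S\<close>, \<open>T\<close> into the orbit polytopes of the restrictions of a point \<open>x\<close> all of whose coordinates on \<open>S\<close> are at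
  least those on \<open>T\<close>. So an iterated coproduct along an ordered partition gives the orbit
  polytopes of the restrictions of one rearrangement \<open>x\<close> that decreases along the blocks; the
  basic character is 1 on all of them exactly if \<open>x\<close> is constant on each block, which means that the
  block sizes refine \<open>\<alpha>\<close>. The ordered partitions with given block sizes are counted by a
  multinomial coefficient.

  For the passage to classes, the normal fan of \<open>P\<close> is encoded by the relation between
  functionals \<open>y\<^sub>0\<close> and \<open>y\<close> that the face of \<open>P\<close> maximizing \<open>y\<^sub>0\<close> is contained in the one
  maximizing \<open>y\<close>. The fan of the face maximizing \<open>w\<close> is then read off at the functionals
  \<open>w + e y\<close> for small \<open>e > 0\<close>.
\<close>

subsection \<open>Maximal faces in a direction\<close>

text \<open>Stated for an arbitrary set, so that the same notion serves a polytope and a finite set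
  spanning it.\<close>

definition supp_face :: "'b::real_inner \<Rightarrow> 'b set \<Rightarrow> 'b set" where
  "supp_face u P = {x\<in>P. \<forall>z\<in>P. u \<bullet> z \<le> u \<bullet> x}"

lemma supp_face_subset: "supp_face u P \<subseteq> P"
  by (auto simp: supp_face_def)

lemma convex_supp_face:
  assumes "convex P"
  shows "convex (supp_face u P)"
proof (cases "supp_face u P = {}")
  case False
  then obtain x0 where x0: "x0 \<in> supp_face u P" by blast
  have "supp_face u P = P \<inter> {x. u \<bullet> x \<ge> u \<bullet> x0}"
    using x0 by (force simp: supp_face_def)
  then show ?thesis
    using assms by (simp add: convex_Int convex_halfspace_ge)
qed auto

lemma supp_face_face_of:
  assumes "convex P"
  shows "supp_face u P face_of P"
proof (cases "supp_face u P = {}")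
  case False
  then obtain x0 where x0: "x0 \<in> supp_face u P" by blast
  have "supp_face u P = P \<inter> {x. u \<bullet> x = u \<bullet> x0}"
    using x0 by (force simp: supp_face_def)
  then show ?thesis
    using assms x0 by (auto intro!: face_of_Int_supporting_hyperplane_le simp: supp_face_def)
qed auto

lemma supp_face_nonempty:
  fixes P :: "'b::euclidean_space set"
  assumes "compact P" "P \<noteq> {}"
  shows "supp_face u P \<noteq> {}"
proof -
  have "continuous_on P (\<lambda>x. u \<bullet> x)"
    by (intro continuous_intros)
  then show ?thesis
    using continuous_attains_sup[OF assms] by (fastforce simp: supp_face_def)
qed

text \<open>Reduces maximal faces of polytopes to finite sets: a face of the hull is spanned by some
  \<open>W \<subseteq> V\<close>, and points of \<open>V\<close> that are maximal over the hull are
  maximal over \<open>V\<close>.\<close>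

lemma supp_face_convex_hull:
  fixes V :: "'b::euclidean_space set"
  assumes "finite V"
  shows "supp_face u (convex hull V) = convex hull (supp_face u V)"
proof
  obtain W where W: "W \<subseteq> V" "supp_face u (convex hull V) = convex hull W"
    using face_of_convex_hull_subset[OF finite_imp_compact[OF assms]
        supp_face_face_of[OF convex_convex_hull]] by metis
  have "W \<subseteq> supp_face u (convex hull V)"
    using W(2) hull_subset[of W convex] by simp
  then have "W \<subseteq> supp_face u V"
    using W(1) hull_subset[of V convex] by (auto simp: supp_face_def)
  then show "supp_face u (convex hull V) \<subseteq> convex hull (supp_face u V)"
    by (simp add: W(2) hull_mono)
next
  have "x \<in> supp_face u (convex hull V)" if x: "x \<in> supp_face u V" for x
  proof -
    have "convex hull V \<subseteq> {z. u \<bullet> z \<le> u \<bullet> x}"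
      using x by (intro hull_minimal convex_halfspace_le) (auto simp: supp_face_def)
    then show ?thesis
      using x hull_subset[of V convex] by (auto simp: supp_face_def)
  qed
  then show "convex hull (supp_face u V) \<subseteq> supp_face u (convex hull V)"
    by (intro hull_minimal convex_supp_face convex_convex_hull) auto
qed

section \<open>Tilting a functional slightly\<close>

text \<open>By continuity \<open>a\<close> decides the sign for small \<open>e\<close>, unless it
  vanishes; then \<open>b\<close> decides.\<close>

lemma eventually_lexicographic:
  fixes a b :: real
  shows "\<forall>\<^sub>F e in at_right 0. (a + e * b \<le> 0) = (a < 0 \<or> a = 0 \<and> b \<le> 0)"
proof -
  have pos: "\<forall>\<^sub>F e in at_right (0::real). 0 < e"
    by (simp add: eventually_at_right_less)
  have lim: "((\<lambda>e. a + e * b) \<longlongrightarrow> a) (at_right 0)"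
    by (auto intro!: tendsto_eq_intros)
  consider "a < 0" | "a > 0" | "a = 0" by linarith
  then show ?thesis
  proof cases
    case 1
    show ?thesis using order_tendstoD(2)[OF lim 1] by eventually_elim (use 1 in auto)
  next
    case 2
    show ?thesis using order_tendstoD(1)[OF lim 2] by eventually_elim (use 2 in auto)
  next
    case 3
    show ?thesis using pos by eventually_elim (use 3 in \<open>auto simp: mult_le_0_iff\<close>)
  qed
qed

text \<open>Comparing two points by \<open>w + e y\<close> is, for small \<open>e\<close>, comparing
  them first by \<open>w\<close> and then by \<open>y\<close>. There are finitely many pairs, so one
  range of \<open>e\<close> serves them all.\<close>

lemma eventually_supp_face_finite:
  assumes "finite V"
  shows "\<forall>\<^sub>F e in at_right (0::real). supp_face (w + e *\<^sub>R y) V = supp_face y (supp_face w V)"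
proof -
  have "\<forall>\<^sub>F e in at_right (0::real). \<forall>x\<in>V. \<forall>z\<in>V.
     ((w + e *\<^sub>R y) \<bullet> z \<le> (w + e *\<^sub>R y) \<bullet> x) =
     (w \<bullet> z < w \<bullet> x \<or> w \<bullet> z = w \<bullet> x \<and> y \<bullet> z \<le> y \<bullet> x)"
  proof (intro eventually_ball_finite assms ballI)
    fix x z
    show "\<forall>\<^sub>F e in at_right (0::real). ((w + e *\<^sub>R y) \<bullet> z \<le> (w + e *\<^sub>R y) \<bullet> x) =
     (w \<bullet> z < w \<bullet> x \<or> w \<bullet> z = w \<bullet> x \<and> y \<bullet> z \<le> y \<bullet> x)"
      using eventually_lexicographic[of "w \<bullet> z - w \<bullet> x" "y \<bullet> z - y \<bullet> x"]
      by eventually_elim (simp add: inner_add_left algebra_simps)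
  qed
  then show ?thesis
  proof eventually_elim
    case (elim e)
    have "x \<in> supp_face (w + e *\<^sub>R y) V \<longleftrightarrow> x \<in> supp_face y (supp_face w V)" for x
    proof
      assume "x \<in> supp_face (w + e *\<^sub>R y) V"
      then show "x \<in> supp_face y (supp_face w V)"
        using elim by (fastforce simp: supp_face_def)
    next
      assume x: "x \<in> supp_face y (supp_face w V)"
      have "w \<bullet> z < w \<bullet> x \<or> w \<bullet> z = w \<bullet> x \<and> y \<bullet> z \<le> y \<bullet> x" if "z \<in> V" for z
      proof (cases "w \<bullet> z = w \<bullet> x")
        case True
        then have "z \<in> supp_face w V" using x that by (auto simp: supp_face_def)
        then show ?thesis using x True by (auto simp: supp_face_def)
      next
        case False
        then show ?thesis using x that by (force simp: supp_face_def)
      qed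
      then show "x \<in> supp_face (w + e *\<^sub>R y) V"
        using x elim by (auto simp: supp_face_def)
    qed
    then show ?case by blast
  qed
qed

text \<open>A maximal face of a maximal face is again a maximal face of \<open>P\<close> itself, so
  statements about \<open>P\<close> can be applied to it.\<close>

lemma eventually_supp_face:
  fixes P :: "'b::euclidean_space set"
  assumes "polytope P"
  shows "\<forall>\<^sub>F e in at_right (0::real). supp_face (w + e *\<^sub>R y) P = supp_face y (supp_face w P)"
proof -
  obtain V where V: "finite V" "P = convex hull V"
    using assms by (auto simp: polytope_def)
  have fin: "finite (supp_face w V)"
    using V(1) supp_face_subset finite_subset by metis
  show ?thesis
    using eventually_supp_face_finite[OF V(1), of w y]
    by eventually_elim (simp add: V fin supp_face_convex_hull)
qed

section \<open>Coordinate subspaces and direct products\<close>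

definition restr :: "'a set \<Rightarrow> real ^ 'a \<Rightarrow> real ^ ('a::finite)" where
  "restr S x = (\<chi> i. if i \<in> S then x $ i else 0)"

lemma restr_nth [simp]: "restr S x $ i = (if i \<in> S then x $ i else 0)"
  by (simp add: restr_def)

lemma restr_in_RI [simp]: "restr S x \<in> RI S"
  by (simp add: RI_def)

lemma restr_id: "x \<in> RI S \<Longrightarrow> restr S x = x"
  by (auto simp: vec_eq_iff RI_def)

lemma RI_add: "x \<in> RI S \<Longrightarrow> y \<in> RI T \<Longrightarrow> x + y \<in> RI (S \<union> T)"
  by (auto simp: RI_def)

lemma RI_mono: "S \<subseteq> T \<Longrightarrow> RI S \<subseteq> RI T"
  by (auto simp: RI_def)

lemma RI_lin: "x \<in> RI S \<Longrightarrow> y \<in> RI S \<Longrightarrow> x + e *\<^sub>R y \<in> RI S"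
  by (auto simp: RI_def)

lemma convex_RI: "convex (RI S)"
  by (auto simp: convex_def RI_def)

lemma restr_add_disjoint:
  assumes "x \<in> RI S" "y \<in> RI T" "S \<inter> T = {}"
  shows "restr S (x + y) = x" "restr T (x + y) = y"
  using assms by (auto simp: vec_eq_iff RI_def disjoint_iff)

lemma restr_decompose:
  assumes "x \<in> RI (S \<union> T)" "S \<inter> T = {}"
  shows "x = restr S x + restr T x"
  using assms by (auto simp: vec_eq_iff RI_def disjoint_iff)

lemma inner_RI: "x \<in> RI S \<Longrightarrow> y \<bullet> x = (\<Sum>i\<in>S. y $ i * x $ i)"
  unfolding inner_vec_def by (intro sum.mono_neutral_cong_right) (auto simp: RI_def)

lemma inner_restr: "x \<in> RI S \<Longrightarrow> restr S y \<bullet> x = y \<bullet> x"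
  by (simp add: inner_RI)

lemma inner_disjoint: "x \<in> RI S \<Longrightarrow> y \<in> RI T \<Longrightarrow> S \<inter> T = {} \<Longrightarrow> y \<bullet> x = 0"
  by (simp add: inner_RI RI_def disjoint_iff)

lemma supp_face_restr: "P \<subseteq> RI S \<Longrightarrow> supp_face (restr S y) P = supp_face y P"
  by (auto simp: supp_face_def inner_restr subset_iff)

lemma supp_face_pprod:
  assumes "P \<noteq> {}" "Q \<noteq> {}"
  shows "supp_face u (pprod P Q) = pprod (supp_face u P) (supp_face u Q)"
proof (intro equalityI subsetI)
  fix x assume "x \<in> supp_face u (pprod P Q)"
  then obtain p q where pq: "x = p + q" "p \<in> P" "q \<in> Q"
    and max: "\<And>p' q'. p' \<in> P \<Longrightarrow> q' \<in> Q \<Longrightarrow> u \<bullet> (p' + q') \<le> u \<bullet> (p + q)"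
    unfolding supp_face_def pprod_def by blast
  then have "p \<in> supp_face u P" "q \<in> supp_face u Q"
    using max[OF _ pq(3)] max[OF pq(2)] by (auto simp: supp_face_def inner_add_right)
  then show "x \<in> pprod (supp_face u P) (supp_face u Q)"
    using pq by (auto simp: pprod_def)
next
  fix x assume "x \<in> pprod (supp_face u P) (supp_face u Q)"
  then show "x \<in> supp_face u (pprod P Q)"
    by (fastforce simp: supp_face_def pprod_def inner_add_right intro: add_mono)
qed

text \<open>Projection recovers each factor, which makes factorizations unique; the other factor
  must be nonempty, or the product would be empty.\<close>

lemma pprod_restr_image:
  assumes "P \<subseteq> RI S" "Q \<subseteq> RI T" "S \<inter> T = {}"
  shows "Q \<noteq> {} \<Longrightarrow> restr S ` pprod P Q = P" "P \<noteq> {} \<Longrightarrow> restr T ` pprod P Q = Q"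
proof -
  have "restr S (x + y) = x" "restr T (x + y) = y" if "x \<in> P" "y \<in> Q" for x y
    using restr_add_disjoint[of x S y T] assms that by auto
  then show "Q \<noteq> {} \<Longrightarrow> restr S ` pprod P Q = P" "P \<noteq> {} \<Longrightarrow> restr T ` pprod P Q = Q"
    by (force simp: pprod_def image_def)+
qed

definition indic :: "'a set \<Rightarrow> real ^ ('a::finite)" where
  "indic S = (\<chi> i. if i \<in> S then 1 else 0)"

lemma indic_nth [simp]: "indic S $ i = (if i \<in> S then 1 else 0)"
  by (simp add: indic_def)

lemma max_face_eq: "max_face S P = supp_face (indic S) P"
proof -
  have "indic S \<bullet> x = (\<Sum>s\<in>S. x $ s)" for x
    unfolding inner_vec_def by (intro sum.mono_neutral_cong_right) auto
  then show ?thesis by (simp add: max_face_def supp_face_def)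
qed

subsection \<open>Normal fans of products of orbit polytopes\<close>

definition orb :: "'a::finite set \<Rightarrow> real ^ 'a \<Rightarrow> (real ^ 'a) set" where
  "orb I p = {perm_act \<sigma> p |\<sigma>. \<sigma> permutes I}"

lemma orbit_polytope_eq: "orbit_polytope I p = convex hull (orb I p)"
  by (simp add: orbit_polytope_def orb_def)

lemma finite_orb: "finite (orb I p)"
  unfolding orb_def using finite_permutations[of I] by (simp add: setcompr_eq_image)

lemma orb_self: "p \<in> orb I p"
  unfolding orb_def by (rule CollectI, rule exI[of _ id]) (auto simp: perm_act_def vec_eq_iff permutes_id)

text \<open>Trades permutations for multisets of coordinates, which split additively over disjoint
  blocks.\<close>

lemma mem_orb_iff:
  assumes "p \<in> RI I"
  shows "x \<in> orb I p \<longleftrightarrow>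
    x \<in> RI I \<and> image_mset (($) x) (mset_set I) = image_mset (($) p) (mset_set I)"
proof
  assume "x \<in> orb I p"
  then obtain \<sigma> where \<sigma>: "\<sigma> permutes I" "x = perm_act \<sigma> p"
    by (auto simp: orb_def)
  have inv: "inv \<sigma> permutes I"
    using \<sigma>(1) by (rule permutes_inv)
  have "x \<in> RI I"
    using assms inv \<sigma>(2) by (auto simp: RI_def perm_act_def permutes_not_in)
  moreover have "($) x = (\<lambda>i. p $ inv \<sigma> i)"
    by (simp add: \<sigma>(2) perm_act_def fun_eq_iff)
  then have "image_mset (($) x) (mset_set I) = image_mset (($) p) (image_mset (inv \<sigma>) (mset_set I))"
    by (simp add: multiset.map_comp comp_def)
  ultimately show "x \<in> RI I \<and> image_mset (($) x) (mset_set I) = image_mset (($) p) (mset_set I)"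
    by (simp add: permutes_image_mset[OF inv])
next
  assume x: "x \<in> RI I \<and> image_mset (($) x) (mset_set I) = image_mset (($) p) (mset_set I)"
  obtain \<pi> where \<pi>: "\<pi> permutes I" "\<forall>i\<in>I. x $ i = p $ \<pi> i"
    using image_mset_eq_implies_permutes[of I "($) x" "($) p"] x by auto
  have "x = perm_act (inv \<pi>) p"
    using \<pi> x assms by (auto simp: vec_eq_iff perm_act_def permutes_inv_inv RI_def)
      (metis permutes_not_in)
  then show "x \<in> orb I p"
    using permutes_inv[OF \<pi>(1)] by (auto simp: orb_def)
qed

lemma orb_subset_RI: "p \<in> RI I \<Longrightarrow> orb I p \<subseteq> RI I"
  by (auto simp: mem_orb_iff)

lemma orb_eq: "p \<in> RI I \<Longrightarrow> x \<in> orb I p \<Longrightarrow> orb I x = orb I p"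
  by (auto simp: mem_orb_iff)

lemma pprod_eq: "pprod P Q = P + Q"
  by (auto simp: pprod_def set_plus_def)

lemma orbit_product_polytope:
  assumes "orbit_product I P"
  shows "polytope P" "P \<noteq> {}" "P \<subseteq> RI I"
proof -
  have "polytope P \<and> P \<noteq> {} \<and> P \<subseteq> RI I"
    using assms
  proof induction
    case (mult S P T q)
    have Q: "polytope (orbit_polytope T q)" "orbit_polytope T q \<noteq> {}" "orbit_polytope T q \<subseteq> RI T"
      using finite_orb[of T q] orb_self[of q T] orb_subset_RI[OF mult(3)]
      by (auto simp: orbit_polytope_eq polytope_def convex_RI subset_hull intro!: exI[of _ "orb T q"])
    have "polytope (pprod P (orbit_polytope T q))"
    proof -
      obtain V W where "finite V" "finite W" "P = convex hull V" "orbit_polytope T q = convex hull W"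
        using mult Q by (auto simp: polytope_def)
      then show ?thesis
        by (auto simp: pprod_eq polytope_def convex_hull_set_plus[symmetric] intro!: exI[of _ "V + W"] finite_set_plus)
    qed
    then show ?case
      using mult Q by (auto simp: pprod_def intro!: RI_add)
  qed (auto simp: RI_def polytope_sing)
  then show "polytope P" "P \<noteq> {}" "P \<subseteq> RI I" by auto
qed

lemma orbit_product_supp_face_nonempty: "orbit_product I P \<Longrightarrow> supp_face y P \<noteq> {}"
  by (simp add: orbit_product_polytope polytope_imp_compact supp_face_nonempty)

text \<open>Faces of a polytope are exposed, so each nonempty face is the maximal face of some
  functional, and its cone consists of the functionals whose maximal face contains it.\<close>

lemma normal_fan_eq_image:
  assumes "orbit_product I P"
  shows "normal_fan I P = (\<lambda>y0. {y\<in>RI I. supp_face y0 P \<subseteq> supp_face y P}) ` RI I"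
proof -
  note P = orbit_product_polytope[OF assms]
  have cone: "normal_cone I P F = {y\<in>RI I. F \<subseteq> supp_face y P}" if "F \<subseteq> P" for F
    using that by (auto simp: normal_cone_def supp_face_def)
  have "normal_cone I P F \<in> (\<lambda>y0. {y\<in>RI I. supp_face y0 P \<subseteq> supp_face y P}) ` RI I"
    if F: "F face_of P" "F \<noteq> {}" for F
  proof -
    obtain a b where ab: "P \<subseteq> {x. a \<bullet> x \<le> b}" "F = P \<inter> {x. a \<bullet> x = b}"
      using exposed_face_of_polyhedron[OF polytope_imp_polyhedron[OF P(1)], of F] F(1)
      by (auto simp: exposed_face_of_def)
    \<comment> \<open>Since \<open>F\<close> is nonempty, \<open>b\<close> is the maximum of
      \<open>a\<close> over \<open>P\<close>; on \<open>P\<close> the functional \<open>a\<close>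
      agrees with its restriction to \<open>I\<close>.\<close>
    have "supp_face (restr I a) P = F"
      using ab F(2) supp_face_restr[OF P(3), of a] by (force simp: supp_face_def)
    then show ?thesis
      using cone[of F] F(1) by (auto simp: face_of_imp_subset image_def intro!: bexI[of _ "restr I a"])
  qed
  moreover have "{y\<in>RI I. supp_face y0 P \<subseteq> supp_face y P} \<in> normal_fan I P" for y0
    unfolding normal_fan_def
    using cone[OF supp_face_subset, of y0] supp_face_face_of[OF polytope_imp_convex[OF P(1)], of y0]
      orbit_product_supp_face_nonempty[OF assms, of y0]
    by (intro CollectI exI[of _ "supp_face y0 P"]) simp
  ultimately show ?thesis
    by (auto simp: normal_fan_def)
qed

section \<open>Comparing fans through inclusions of maximal faces\<close>

definition face_equiv :: "'a::finite set \<Rightarrow> (real ^ 'a) set \<Rightarrow> (real ^ 'a) set \<Rightarrow> bool" where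
  "face_equiv I P Q \<longleftrightarrow> (\<forall>y0\<in>RI I. \<forall>y\<in>RI I.
     supp_face y0 P \<subseteq> supp_face y P \<longleftrightarrow> supp_face y0 Q \<subseteq> supp_face y Q)"

text \<open>A fan is a bare set of cones, so equality of fans does not say at once that the cones of
  \<open>y0\<close> for \<open>P\<close> and for \<open>Q\<close> agree. This follows because a cone
  contains the functional it comes from.\<close>

lemma normal_fan_eq_iff:
  assumes "orbit_product I P" "orbit_product I Q"
  shows "normal_fan I P = normal_fan I Q \<longleftrightarrow> face_equiv I P Q"
proof
  assume "face_equiv I P Q"
  then show "normal_fan I P = normal_fan I Q"
    unfolding normal_fan_eq_image[OF assms(1)] normal_fan_eq_image[OF assms(2)]
    by (intro image_cong) (auto simp: face_equiv_def)
next
  have transfer: "supp_face y0 P \<subseteq> supp_face y P"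
    if eq: "normal_fan I P = normal_fan I Q" and P: "orbit_product I P" and Q: "orbit_product I Q"
      and y: "y0 \<in> RI I" "y \<in> RI I" and sub: "supp_face y0 Q \<subseteq> supp_face y Q" for P Q y0 y
  proof -
    have "{y\<in>RI I. supp_face y0 P \<subseteq> supp_face y P} \<in> normal_fan I Q"
      using y(1) by (auto simp: eq[symmetric] normal_fan_eq_image[OF P])
    then obtain y1 where y1: "y1 \<in> RI I"
      "{y\<in>RI I. supp_face y0 P \<subseteq> supp_face y P} = {y\<in>RI I. supp_face y1 Q \<subseteq> supp_face y Q}"
      by (auto simp: normal_fan_eq_image[OF Q])
    \<comment> \<open>Being in its own cone, \<open>y0\<close> has a maximal face over
      \<open>Q\<close> that contains the one of \<open>y1\<close>; by \<open>sub\<close> so has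
      \<open>y\<close>.\<close>
    then have "y0 \<in> {y\<in>RI I. supp_face y1 Q \<subseteq> supp_face y Q}"
      using y(1) by blast
    then have "y \<in> {y\<in>RI I. supp_face y1 Q \<subseteq> supp_face y Q}"
      using sub y(2) by blast
    then show ?thesis
      using y1(2) by blast
  qed
  assume "normal_fan I P = normal_fan I Q"
  then show "face_equiv I P Q"
    unfolding face_equiv_def
    using transfer[of P Q] transfer[of Q P] assms by (intro ballI iffI) simp_all
qed

lemma normal_equiv_iff:
  "(P, Q) \<in> normal_equiv I \<longleftrightarrow> orbit_product I P \<and> orbit_product I Q \<and> face_equiv I P Q"
  unfolding normal_equiv_def using normal_fan_eq_iff[of I P Q] by simp blast

lemma face_equiv_supp_face:
  assumes "orbit_product I P" "orbit_product I Q" "face_equiv I P Q" "w \<in> RI I"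
  shows "face_equiv I (supp_face w P) (supp_face w Q)"
  unfolding face_equiv_def
proof (intro ballI)
  fix y0 y assume y: "y0 \<in> RI I" "y \<in> RI I"
  note poly = orbit_product_polytope(1)[OF assms(1)] orbit_product_polytope(1)[OF assms(2)]
  \<comment> \<open>A single \<open>e\<close> has to serve both functionals and both polytopes; then
    the claim is the hypothesis at the tilted functionals.\<close>
  have "\<forall>\<^sub>F e in at_right (0::real).
    (supp_face (w + e *\<^sub>R y0) P = supp_face y0 (supp_face w P) \<and>
     supp_face (w + e *\<^sub>R y) P = supp_face y (supp_face w P)) \<and>
    (supp_face (w + e *\<^sub>R y0) Q = supp_face y0 (supp_face w Q) \<and>
     supp_face (w + e *\<^sub>R y) Q = supp_face y (supp_face w Q))"
    by (intro eventually_conj eventually_supp_face poly)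
  then obtain e where e:
     "supp_face (w + e *\<^sub>R y0) P = supp_face y0 (supp_face w P)"
     "supp_face (w + e *\<^sub>R y) P = supp_face y (supp_face w P)"
     "supp_face (w + e *\<^sub>R y0) Q = supp_face y0 (supp_face w Q)"
     "supp_face (w + e *\<^sub>R y) Q = supp_face y (supp_face w Q)"
    using eventually_happens'[OF trivial_limit_at_right_real[of 0]] by blast
  show "supp_face y0 (supp_face w P) \<subseteq> supp_face y (supp_face w P) \<longleftrightarrow>
        supp_face y0 (supp_face w Q) \<subseteq> supp_face y (supp_face w Q)"
    unfolding e[symmetric]
    using assms(3) RI_lin[OF assms(4) y(1), of e] RI_lin[OF assms(4) y(2), of e]
    by (simp add: face_equiv_def)
qed

lemma pprod_commute: "pprod P Q = pprod Q P"
  by (simp add: pprod_eq add.commute)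

lemma supp_face_pprod_left:
  assumes "A \<subseteq> RI S" "B \<subseteq> RI T" "S \<inter> T = {}" "A \<noteq> {}" "B \<noteq> {}" "y \<in> RI S"
  shows "supp_face y (pprod A B) = pprod (supp_face y A) B"
proof -
  have "y \<bullet> b = 0" if "b \<in> B" for b
    using inner_disjoint[of b T y S] assms that by auto
  then have "supp_face y B = B"
    by (auto simp: supp_face_def)
  then show ?thesis
    by (simp add: supp_face_pprod assms)
qed

text \<open>Functionals supported on \<open>S\<close> see only the first factor, so testing with
  them gives the inclusions between its faces. The second factor is reached by commuting
  \<open>pprod\<close>.\<close>

lemma face_equiv_pprod_left:
  assumes "A \<subseteq> RI S" "B \<subseteq> RI T" "A' \<subseteq> RI S" "B' \<subseteq> RI T" "S \<inter> T = {}"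
    "A \<noteq> {}" "B \<noteq> {}" "A' \<noteq> {}" "B' \<noteq> {}"
    and eq: "face_equiv (S \<union> T) (pprod A B) (pprod A' B')"
  shows "face_equiv S A A'"
proof -
  have sub: "supp_face y0 (pprod A B) \<subseteq> supp_face y (pprod A B) \<longleftrightarrow> supp_face y0 A \<subseteq> supp_face y A"
    if "A \<subseteq> RI S" "B \<subseteq> RI T" "A \<noteq> {}" "B \<noteq> {}" "y0 \<in> RI S" "y \<in> RI S" for A B y0 y
  proof
    have A: "restr S ` pprod (supp_face y A) B = supp_face y A" for y
      using pprod_restr_image(1)[of "supp_face y A" S B T] that assms(5) supp_face_subset[of y A] by blast
    assume "supp_face y0 (pprod A B) \<subseteq> supp_face y (pprod A B)"
    then have "pprod (supp_face y0 A) B \<subseteq> pprod (supp_face y A) B"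
      using that assms(5) by (simp add: supp_face_pprod_left)
    then show "supp_face y0 A \<subseteq> supp_face y A"
      using A by (metis image_mono)
  next
    assume "supp_face y0 A \<subseteq> supp_face y A"
    then show "supp_face y0 (pprod A B) \<subseteq> supp_face y (pprod A B)"
      using that assms(5) by (simp add: supp_face_pprod_left) (auto simp: pprod_def)
  qed
  show ?thesis
    unfolding face_equiv_def
  proof (intro ballI)
    fix y0 y assume y: "y0 \<in> RI S" "y \<in> RI S"
    then have "y0 \<in> RI (S \<union> T)" "y \<in> RI (S \<union> T)"
      using RI_mono[of S "S \<union> T"] by auto
    then show "supp_face y0 A \<subseteq> supp_face y A \<longleftrightarrow> supp_face y0 A' \<subseteq> supp_face y A'"
      using eq y sub[of A B y0 y] sub[of A' B' y0 y] assms by (simp add: face_equiv_def)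
  qed
qed

text \<open>Discharges the definite description: both factors are projections of the maximal face,
  hence determined by it.\<close>

lemma face_split_eqI:
  assumes "orbit_product S A" "orbit_product T B" "max_face S P = pprod A B" "S \<inter> T = {}"
  shows "face_split S T P = (A, B)"
  unfolding face_split_def
proof (rule the_equality)
  show "case (A, B) of (A, B) \<Rightarrow> orbit_product S A \<and> orbit_product T B \<and> max_face S P = pprod A B"
    using assms by simp
next
  fix X assume X: "case X of (A, B) \<Rightarrow> orbit_product S A \<and> orbit_product T B \<and> max_face S P = pprod A B"
  obtain A' B' where X': "X = (A', B')" by fastforce
  then have X: "orbit_product S A'" "orbit_product T B'" "pprod A' B' = pprod A B"
    using X assms by simp_all
  note AB = orbit_product_polytope(2,3)[OF assms(1)] orbit_product_polytope(2,3)[OF assms(2)]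
  note AB' = orbit_product_polytope(2,3)[OF X(1)] orbit_product_polytope(2,3)[OF X(2)]
  have "A = A'"
    using pprod_restr_image(1)[OF AB(2,4) assms(4) AB(3)] pprod_restr_image(1)[OF AB'(2,4) assms(4) AB'(3)]
    by (simp add: X(3))
  moreover have "B = B'"
    using pprod_restr_image(2)[OF AB(2,4) assms(4) AB(1)] pprod_restr_image(2)[OF AB'(2,4) assms(4) AB'(1)]
    by (simp add: X(3))
  ultimately show "X = (A, B)"
    using X' by simp
qed

subsection \<open>Maximal faces of orbit polytopes and the coproduct\<close>

text \<open>The equality case of the rearrangement inequality; indices tied under \<open>y\<close>
  are left free.\<close>

definition comonotone :: "'a set \<Rightarrow> ('a \<Rightarrow> real) \<Rightarrow> ('a \<Rightarrow> real) \<Rightarrow> bool" where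
  "comonotone I y x \<longleftrightarrow> (\<forall>i\<in>I. \<forall>j\<in>I. y j < y i \<longrightarrow> x j \<le> x i)"

text \<open>Among the maximizers of \<open>y\<close> take one with the largest \<open>x\<close>; an
  index with smaller \<open>y\<close> cannot exceed it in \<open>x\<close>.\<close>

lemma comonotone_common_max:
  assumes "finite I" "I \<noteq> {}" "comonotone I y x"
  obtains i where "i \<in> I" "\<And>j. j \<in> I \<Longrightarrow> y j \<le> y i" "\<And>j. j \<in> I \<Longrightarrow> x j \<le> x i"
proof -
  define K where "K = {i\<in>I. y i = Max (y ` I)}"
  have fin: "finite K"
    using assms(1) by (simp add: K_def)
  have "Max (y ` I) \<in> y ` I"
    using assms(1,2) by (intro Max_in) auto
  then have "K \<noteq> {}"
    by (force simp: K_def)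
  then have "Max (x ` K) \<in> x ` K"
    using fin by (intro Max_in) auto
  then obtain i where i: "i \<in> K" "x i = Max (x ` K)"
    by force
  then have i: "i \<in> K" "\<And>j. j \<in> K \<Longrightarrow> x j \<le> x i"
    using fin by auto
  have max: "y j \<le> y i" if "j \<in> I" for j
    using i(1) that assms(1) by (simp add: K_def)
  have max': "x j \<le> x i" if "j \<in> I" for j
  proof (cases "y j = y i")
    case True
    then show ?thesis using i that by (simp add: K_def)
  next
    case False
    then show ?thesis using assms(3) max[OF that] that i(1) by (simp add: comonotone_def K_def)
  qed
  have "i \<in> I"
    using i(1) by (simp add: K_def)
  from that[OF this max max'] show ?thesis by blast
qed

text \<open>Both sums pair the sorted values of \<open>y\<close> with the sorted values of \<open>x\<close>; the induction
  removes a simultaneous maximum.\<close>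

lemma comonotone_sum_eq:
  assumes "finite I" "finite J"
    "image_mset y (mset_set I) = image_mset y' (mset_set J)"
    "image_mset x (mset_set I) = image_mset x' (mset_set J)"
    "comonotone I y x" "comonotone J y' x'"
  shows "(\<Sum>i\<in>I. y i * x i) = (\<Sum>j\<in>J. y' j * x' j)"
  using assms
proof (induction "card I" arbitrary: I J)
  case 0
  then have "I = {}" by simp
  moreover from this have "J = {}"
    using "0.prems" by (simp add: mset_set_empty_iff)
  ultimately show ?case by simp
next
  case (Suc n)
  have "I \<noteq> {}" using Suc.hyps by auto
  moreover from this have "J \<noteq> {}"
    using Suc.prems by (auto simp: mset_set_empty_iff)
  ultimately obtain i j where
    i: "i \<in> I" "\<And>k. k \<in> I \<Longrightarrow> y k \<le> y i" "\<And>k. k \<in> I \<Longrightarrow> x k \<le> x i" and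
    j: "j \<in> J" "\<And>k. k \<in> J \<Longrightarrow> y' k \<le> y' j" "\<And>k. k \<in> J \<Longrightarrow> x' k \<le> x' j"
    using comonotone_common_max Suc.prems by metis
  have "y ` I = y' ` J" "x ` I = x' ` J"
    using arg_cong[OF Suc.prems(3), of set_mset] arg_cong[OF Suc.prems(4), of set_mset] Suc.prems(1,2)
    by simp_all
  moreover have "Max (y ` I) = y i" "Max (x ` I) = x i" "Max (y' ` J) = y' j" "Max (x' ` J) = x' j"
    using i j Suc.prems(1,2) by (auto intro!: Max_eqI)
  ultimately have eq: "y i = y' j" "x i = x' j"
    by simp_all
  have I: "mset_set I = add_mset i (mset_set (I - {i}))"
    using mset_set.remove[OF Suc.prems(1) i(1)] by simp
  have J: "mset_set J = add_mset j (mset_set (J - {j}))"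
    using mset_set.remove[OF Suc.prems(2) j(1)] by simp
  have "(\<Sum>i\<in>I - {i}. y i * x i) = (\<Sum>j\<in>J - {j}. y' j * x' j)"
  proof (rule Suc.hyps)
    show "n = card (I - {i})"
      using Suc.hyps(2) i(1) by simp
    show "image_mset y (mset_set (I - {i})) = image_mset y' (mset_set (J - {j}))"
      "image_mset x (mset_set (I - {i})) = image_mset x' (mset_set (J - {j}))"
      using Suc.prems(3,4) eq by (simp_all add: I J)
  qed (use Suc.prems in \<open>auto simp: comonotone_def\<close>)
  then show ?case
    using eq by (simp add: sum.remove[OF Suc.prems(1) i(1)] sum.remove[OF Suc.prems(2) j(1)])
qed

lemma swap_mem_orb:
  assumes "p \<in> RI I" "x \<in> orb I p" "i \<in> I" "j \<in> I"
  shows "(\<chi> k. x $ Transposition.transpose i j k) \<in> orb I p"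
proof -
  have "(\<chi> k. x $ Transposition.transpose i j k) = perm_act (Transposition.transpose i j) x"
    by (simp add: perm_act_def)
  then have "(\<chi> k. x $ Transposition.transpose i j k) \<in> orb I x"
    using permutes_swap_id[OF assms(3,4)] by (auto simp: orb_def)
  then show ?thesis
    using orb_eq[OF assms(1,2)] by simp
qed

text \<open>The rearrangement inequality: a pair in the wrong order can be swapped with gain, and
  all comonotone rearrangements give \<open>y\<close> the same value.\<close>

lemma supp_face_orb:
  assumes p: "p \<in> RI I"
  shows "supp_face y (orb I p) = {x\<in>orb I p. comonotone I (($) y) (($) x)}"
proof -
  have 1: "comonotone I (($) y) (($) x)" if x: "x \<in> supp_face y (orb I p)" for x
    unfolding comonotone_def
  proof (intro ballI impI, rule ccontr)
    fix i j assume ij: "i \<in> I" "j \<in> I" "y $ j < y $ i" "\<not> x $ j \<le> x $ i"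
    define z where "z = (\<chi> k. x $ Transposition.transpose i j k)"
    have "z = x + (x $ j - x $ i) *\<^sub>R (axis i 1 - axis j 1)"
      using ij by (auto simp: vec_eq_iff z_def axis_def Transposition.transpose_def)
    \<comment> \<open>Both factors of the added product are positive, so the swap improves on a
      maximizer.\<close>
    then have "y \<bullet> z = y \<bullet> x + (x $ j - x $ i) * (y $ i - y $ j)"
      by (simp add: inner_add_right inner_diff_right inner_axis)
    then have "y \<bullet> x < y \<bullet> z"
      using ij by simp
    moreover have "z \<in> orb I p"
      unfolding z_def using x ij supp_face_subset by (intro swap_mem_orb p) blast+
    ultimately show False
      using x by (force simp: supp_face_def)
  qed
  have "x \<in> supp_face y (orb I p)" if x: "x \<in> orb I p" "comonotone I (($) y) (($) x)" for x
  proof -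
    \<comment> \<open>Some maximizer exists; it is comonotone by the first half, so \<open>x\<close>
      attains the same value.\<close>
    obtain z where z: "z \<in> supp_face y (orb I p)"
      using supp_face_nonempty[OF finite_imp_compact[OF finite_orb], of I p y] orb_self by blast
    then have z': "z \<in> orb I p"
      using supp_face_subset by blast
    have "(\<Sum>i\<in>I. y $ i * x $ i) = (\<Sum>i\<in>I. y $ i * z $ i)"
      using x z' 1[OF z] by (intro comonotone_sum_eq) (auto simp: mem_orb_iff[OF p])
    then have "y \<bullet> x = y \<bullet> z"
      using inner_RI[of x I y] inner_RI[of z I y] x(1) z' by (simp add: mem_orb_iff[OF p])
    then show ?thesis
      using z x(1) by (simp add: supp_face_def)
  qed
  then show ?thesis
    using 1 supp_face_subset by blast
qed

section \<open>Cutting an orbit along two blocks\<close>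

text \<open>Sorting \<open>M + N\<close> lists \<open>N\<close> first and then \<open>M\<close>, so
  the sum together with the size of \<open>M\<close> determines both.\<close>

lemma multiset_split_unique:
  fixes M N :: "'b::linorder multiset"
  assumes "M + N = M' + N'" "size M = size M'"
    "\<And>a b. a \<in># M \<Longrightarrow> b \<in># N \<Longrightarrow> b \<le> a" "\<And>a b. a \<in># M' \<Longrightarrow> b \<in># N' \<Longrightarrow> b \<le> a"
  shows "M = M' \<and> N = N'"
proof -
  have split: "sorted_list_of_multiset (M + N) = sorted_list_of_multiset N @ sorted_list_of_multiset M"
    if "\<And>a b. a \<in># M \<Longrightarrow> b \<in># N \<Longrightarrow> b \<le> a" for M N :: "'b multiset"
  proof -
    obtain xs ys where xs: "M = mset xs" and ys: "N = mset ys" by (metis ex_mset)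
    have "M + N = mset (ys @ xs)"
      by (simp add: xs ys)
    then have "sorted_list_of_multiset (M + N) = sort (ys @ xs)"
      by (simp only: sorted_list_of_multiset_mset)
    also have "\<dots> = sort ys @ sort xs"
      by (rule sort_append) (simp add: that xs ys)
    finally show ?thesis
      by (simp add: xs ys)
  qed
  have "length (sorted_list_of_multiset M) = length (sorted_list_of_multiset M')"
    using assms(2) by (metis mset_sorted_list_of_multiset size_mset)
  then have "sorted_list_of_multiset M = sorted_list_of_multiset M'"
    "sorted_list_of_multiset N = sorted_list_of_multiset N'"
    using split[of M N] split[of M' N'] assms by simp_all
  then show ?thesis
    by (metis mset_sorted_list_of_multiset)
qed

lemma image_mset_restr:
  "image_mset (($) (restr S x)) (mset_set S) = image_mset (($) x) (mset_set (S :: 'a::finite set))"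
  by (rule image_mset_cong) simp

lemma orb_restr_pprod:
  assumes "x \<in> RI (S \<union> T)" "S \<inter> T = {}"
  shows "pprod (orb S (restr S x)) (orb T (restr T x)) =
    {z\<in>RI (S \<union> T). image_mset (($) z) (mset_set S) = image_mset (($) x) (mset_set S) \<and>
      image_mset (($) z) (mset_set T) = image_mset (($) x) (mset_set T)}"
proof -
  have "z \<in> pprod (orb S (restr S x)) (orb T (restr T x)) \<longleftrightarrow>
     z \<in> RI (S \<union> T) \<and> restr S z \<in> orb S (restr S x) \<and> restr T z \<in> orb T (restr T x)" for z
  proof
    assume "z \<in> pprod (orb S (restr S x)) (orb T (restr T x))"
    then obtain a b where "z = a + b" "a \<in> orb S (restr S x)" "b \<in> orb T (restr T x)"
      by (auto simp: pprod_def)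
    then show "z \<in> RI (S \<union> T) \<and> restr S z \<in> orb S (restr S x) \<and> restr T z \<in> orb T (restr T x)"
      using orb_subset_RI[of "restr S x" S] orb_subset_RI[of "restr T x" T]
        restr_add_disjoint[of a S b T] RI_add[of a S b T] assms(2) by (auto dest!: subsetD)
  next
    assume "z \<in> RI (S \<union> T) \<and> restr S z \<in> orb S (restr S x) \<and> restr T z \<in> orb T (restr T x)"
    then show "z \<in> pprod (orb S (restr S x)) (orb T (restr T x))"
      using restr_decompose[of z S T] assms(2) unfolding pprod_def by blast
  qed
  then show ?thesis
    by (auto simp: mem_orb_iff image_mset_restr)
qed

text \<open>The maximal points of the orbit are the rearrangements whose coordinates on
  \<open>S\<close> dominate those on \<open>T\<close>. As \<open>x\<close> is one of them, the
  others have the same multisets as \<open>x\<close> on \<open>S\<close> and on \<open>T\<close>, so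
  they rearrange \<open>x\<close> within each block.\<close>

lemma supp_face_orbit_polytope:
  assumes x: "x \<in> RI (S \<union> T)" and disj: "S \<inter> T = {}"
    and ge: "\<And>i j. i \<in> S \<Longrightarrow> j \<in> T \<Longrightarrow> x $ j \<le> x $ i"
  shows "supp_face (indic S) (orbit_polytope (S \<union> T) x) =
    pprod (orbit_polytope S (restr S x)) (orbit_polytope T (restr T x))"
proof -
  have mset: "mset_set (S \<union> T) = mset_set S + mset_set T"
    using disj by (simp add: mset_set_Union)
  have mono: "comonotone (S \<union> T) (($) (indic S)) (($) z) \<longleftrightarrow> (\<forall>i\<in>S. \<forall>j\<in>T. z $ j \<le> z $ i)" for z
    using disj by (auto simp: comonotone_def)
  have "supp_face (indic S) (orb (S \<union> T) x) = pprod (orb S (restr S x)) (orb T (restr T x))"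
    unfolding supp_face_orb[OF x] orb_restr_pprod[OF x disj]
  proof (intro Collect_cong, unfold mono)
    fix z
    let ?mS = "\<lambda>z. image_mset (($) z) (mset_set S)" and ?mT = "\<lambda>z. image_mset (($) z) (mset_set T)"
    show "z \<in> orb (S \<union> T) x \<and> (\<forall>i\<in>S. \<forall>j\<in>T. z $ j \<le> z $ i) \<longleftrightarrow>
       z \<in> RI (S \<union> T) \<and> ?mS z = ?mS x \<and> ?mT z = ?mT x" (is "?L \<longleftrightarrow> ?R")
    proof
      assume ?L
      then have "?mS z + ?mT z = ?mS x + ?mT x"
        by (simp add: mem_orb_iff[OF x] mset)
      then have "?mS z = ?mS x \<and> ?mT z = ?mT x"
        by (rule multiset_split_unique) (use ge \<open>?L\<close> in auto)
      then show ?R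
        using \<open>?L\<close> by (simp add: mem_orb_iff[OF x])
    next
      assume R: ?R
      have "($) z ` S = ($) x ` S" "($) z ` T = ($) x ` T"
        using arg_cong[OF conjunct1[OF conjunct2[OF R]], of set_mset]
          arg_cong[OF conjunct2[OF conjunct2[OF R]], of set_mset] by simp_all
      moreover have "\<forall>a\<in>($) x ` S. \<forall>b\<in>($) x ` T. b \<le> a"
        using ge by auto
      ultimately have "\<forall>a\<in>($) z ` S. \<forall>b\<in>($) z ` T. b \<le> a"
        by simp
      then show ?L
        using R by (simp add: mem_orb_iff[OF x] mset)
    qed
  qed
  then show ?thesis
    by (simp add: orbit_polytope_eq supp_face_convex_hull finite_orb pprod_eq convex_hull_set_plus)
qed

section \<open>The coproduct on normal equivalence classes\<close>

lemma supp_face_indic_Int: "P \<subseteq> RI S \<Longrightarrow> supp_face (indic (S \<inter> U)) P = supp_face (indic U) P"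
proof -
  assume P: "P \<subseteq> RI S"
  have "restr S (indic U) = indic (S \<inter> U)"
    by (simp add: vec_eq_iff)
  then show ?thesis
    using supp_face_restr[OF P, of "indic U"] by simp
qed

lemma orbit_polytope_cong:
  assumes "p \<in> RI I" "x \<in> orb I p"
  shows "orbit_polytope I x = orbit_polytope I p"
  by (simp add: orbit_polytope_eq orb_eq[OF assms])

lemma pprod_interchange: "pprod (pprod A B) (pprod C D) = pprod (pprod A C) (pprod B D)"
  by (simp add: pprod_eq add_ac)

text \<open>Existence of the splitting. The set \<open>U\<close> is arbitrary, so that the induction
  can cut every factor along the same \<open>U\<close>.\<close>

lemma orbit_product_max_face:
  assumes "orbit_product I P"
  shows "\<exists>A B. orbit_product (I \<inter> U) A \<and> orbit_product (I - U) B \<and> supp_face (indic U) P = pprod A B"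
  using assms
proof induction
  case empty
  have "supp_face (indic U) {0} = pprod {0} {0::real^'a}"
    by (auto simp: supp_face_def pprod_def)
  then show ?case
    using orbit_product.empty by auto
next
  case (mult S P T q)
  obtain A B where AB: "orbit_product (S \<inter> U) A" "orbit_product (S - U) B"
    "supp_face (indic U) P = pprod A B"
    using mult by blast
  \<comment> \<open>A maximal rearrangement of \<open>q\<close> has its coordinates on
    \<open>T \<inter> U\<close> above those on \<open>T - U\<close>, as needed to cut the orbit
    polytope there.\<close>
  obtain x where x: "x \<in> supp_face (indic (T \<inter> U)) (orb T q)"
    using supp_face_nonempty[OF finite_imp_compact[OF finite_orb], of T q] orb_self by blast
  have xo: "x \<in> orb T q" and mono: "comonotone T (($) (indic (T \<inter> U))) (($) x)"
    using x by (auto simp: supp_face_orb[OF mult(3)])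
  have T: "(T \<inter> U) \<union> (T - U) = T" by blast
  have "supp_face (indic (T \<inter> U)) (orbit_polytope ((T \<inter> U) \<union> (T - U)) x) =
      pprod (orbit_polytope (T \<inter> U) (restr (T \<inter> U) x)) (orbit_polytope (T - U) (restr (T - U) x))"
    by (rule supp_face_orbit_polytope)
      (use mono xo orb_subset_RI[OF mult(3)] in \<open>auto simp: T comonotone_def\<close>)
  moreover have Q: "orbit_product T (orbit_polytope T q)"
    by (rule orbit_product_orbit_polytope[OF mult(3)])
  ultimately have QU: "supp_face (indic U) (orbit_polytope T q) =
      pprod (orbit_polytope (T \<inter> U) (restr (T \<inter> U) x)) (orbit_polytope (T - U) (restr (T - U) x))"
    using supp_face_indic_Int[OF orbit_product_polytope(3)[OF Q], of U]
    by (simp add: T orbit_polytope_cong[OF mult(3) xo])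
  let ?A = "pprod A (orbit_polytope (T \<inter> U) (restr (T \<inter> U) x))"
  let ?B = "pprod B (orbit_polytope (T - U) (restr (T - U) x))"
  have "orbit_product (S \<inter> U \<union> T \<inter> U) ?A" "orbit_product ((S - U) \<union> (T - U)) ?B"
    using mult(2) by (auto intro!: orbit_product.mult AB)
  moreover have "supp_face (indic U) (pprod P (orbit_polytope T q)) = pprod ?A ?B"
    using orbit_product_polytope(2)[OF Q] orbit_product_polytope(2)[OF mult(1)]
    by (simp add: supp_face_pprod AB QU pprod_interchange)
  ultimately show ?case
    unfolding Int_Un_distrib2 Un_Diff by blast
qed

lemma normal_class_eqI:
  "(P, Q) \<in> normal_equiv I \<Longrightarrow> normal_equiv I `` {P} = normal_equiv I `` {Q}"
  by (rule equiv_class_eq[OF equiv_normal_equiv])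

text \<open>Independence of the representative: maximal faces of equivalent polytopes are
  equivalent, and so are their factors. Thus the unions defining \<open>coproduct\<close> run over
  equal sets.\<close>

lemma coproduct_class:
  assumes disj: "S \<inter> T = {}" and P: "orbit_product (S \<union> T) P"
    and A: "orbit_product S A" and B: "orbit_product T B" and max: "max_face S P = pprod A B"
  shows "coproduct S T (normal_equiv (S \<union> T) `` {P}) = (normal_equiv S `` {A}, normal_equiv T `` {B})"
proof -
  have "normal_equiv S `` {fst (face_split S T Q)} = normal_equiv S `` {A} \<and>
        normal_equiv T `` {snd (face_split S T Q)} = normal_equiv T `` {B}"
    if Q: "(P, Q) \<in> normal_equiv (S \<union> T)" for Q
  proof -
    have Q': "orbit_product (S \<union> T) Q" "face_equiv (S \<union> T) P Q"
      using Q by (auto simp: normal_equiv_iff)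
    have ST: "(S \<union> T) \<inter> S = S" "(S \<union> T) - S = T"
      using disj by auto
    obtain A' B' where AB': "orbit_product S A'" "orbit_product T B'" "max_face S Q = pprod A' B'"
      using orbit_product_max_face[OF Q'(1), of S] by (auto simp: ST max_face_eq)
    have "indic S \<in> RI (S \<union> T)"
      by (simp add: RI_def)
    then have eq: "face_equiv (S \<union> T) (pprod A B) (pprod A' B')"
      using face_equiv_supp_face[OF P Q'] by (simp add: max[symmetric] AB'(3)[symmetric] max_face_eq)
    note props = orbit_product_polytope(2,3)
    have "face_equiv S A A'"
      using face_equiv_pprod_left[OF _ _ _ _ disj _ _ _ _ eq] props[OF A] props[OF B]
        props[OF AB'(1)] props[OF AB'(2)] by simp
    moreover have "face_equiv T B B'"
      using face_equiv_pprod_left[of B T A S B' A'] eq disj props[OF A] props[OF B]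
        props[OF AB'(1)] props[OF AB'(2)] by (simp add: pprod_commute Un_commute Int_commute)
    ultimately have "(A, A') \<in> normal_equiv S" "(B, B') \<in> normal_equiv T"
      using A B AB' by (simp_all add: normal_equiv_iff)
    then show ?thesis
      using normal_class_eqI face_split_eqI[OF AB' disj] by fastforce
  qed
  \<comment> \<open>The unions must have at least one index; \<open>P\<close> itself is one.\<close>
  moreover have "(P, P) \<in> normal_equiv (S \<union> T)"
    using P by (simp add: normal_equiv_iff face_equiv_def)
  ultimately show ?thesis
    unfolding coproduct_def by (intro arg_cong2[where f = Pair]) (auto simp del: Image_singleton_iff)
qed

section \<open>Iterated coproducts and the basic character\<close>

definition decreasing_along :: "'a::finite set list \<Rightarrow> real ^ 'a \<Rightarrow> bool" where
  "decreasing_along Ss x \<longleftrightarrow> sorted_wrt (\<lambda>S T. \<forall>i\<in>S. \<forall>j\<in>T. x $ j \<le> x $ i) Ss"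

text \<open>The restriction is built in so that one global vector \<open>x\<close> describes the
  classes on all blocks.\<close>

abbreviation orbit_normal_class :: "'a::finite set \<Rightarrow> real ^ 'a \<Rightarrow> (real ^ 'a) set set" where
  "orbit_normal_class S x \<equiv> normal_equiv S `` {orbit_polytope S (restr S x)}"

text \<open>Each coproduct peels off the first block. The same \<open>x\<close> is decreasing along
  the remaining blocks, so no new representative has to be chosen.\<close>

lemma iter_coproduct_orbit_class:
  assumes "sorted_wrt disjnt Ss" "decreasing_along Ss x"
  shows "iter_coproduct Ss (orbit_normal_class (\<Union>(set Ss)) x) = map (\<lambda>S. orbit_normal_class S x) Ss"
  using assms
proof (induction Ss)
  case (Cons S Ss)
  show ?case
  proof (cases Ss)
    case (Cons S' Ss')
    define T where "T = \<Union>(set Ss)"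
    have disj: "S \<inter> T = {}"
      using Cons.prems by (auto simp: T_def disjnt_def)
    have restr: "restr S (restr (S \<union> T) x) = restr S x" "restr T (restr (S \<union> T) x) = restr T x"
      by (auto simp: vec_eq_iff)
    have "supp_face (indic S) (orbit_polytope (S \<union> T) (restr (S \<union> T) x)) =
      pprod (orbit_polytope S (restr S (restr (S \<union> T) x))) (orbit_polytope T (restr T (restr (S \<union> T) x)))"
      using Cons.prems by (intro supp_face_orbit_polytope disj) (auto simp: decreasing_along_def T_def)
    then have "coproduct S T (orbit_normal_class (S \<union> T) x) = (orbit_normal_class S x, orbit_normal_class T x)"
      by (intro coproduct_class disj orbit_product_orbit_polytope) (simp_all add: max_face_eq restr)
    moreover have "iter_coproduct Ss (orbit_normal_class T x) = map (\<lambda>S. orbit_normal_class S x) Ss"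
      unfolding T_def using Cons.prems by (intro Cons.IH) (auto simp: decreasing_along_def)
    ultimately show ?thesis
      by (simp add: Cons T_def)
  qed simp
qed simp

lemma basic_char_orbit_class:
  fixes S :: "'a::finite set"
  shows "(basic_char S (orbit_normal_class S x) :: 'k::field) =
    (if (($) x) constant_on S then 1 else 0)"
proof (cases "(($) x) constant_on S")
  case True
  then obtain v where v: "\<And>i. i \<in> S \<Longrightarrow> x $ i = v"
    by (auto simp: constant_on_def)
  have "z = restr S x" if z: "z \<in> orb S (restr S x)" for z
  proof -
    have "z $ i = x $ i" if i: "i \<in> S" for i
    proof -
      have "z $ i \<in> ($) z ` S" using i by simp
      also have "($) z ` S = ($) x ` S"
      proof -
        have "image_mset (($) z) (mset_set S) = image_mset (($) x) (mset_set S)"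
          using z by (simp add: mem_orb_iff image_mset_restr)
        from arg_cong[OF this, of set_mset] show ?thesis by simp
      qed
      finally obtain k where "k \<in> S" "z $ i = x $ k" by blast
      then show ?thesis using v i by simp
    qed
    then show ?thesis
      using z by (auto simp: vec_eq_iff mem_orb_iff RI_def)
  qed
  then have "orb S (restr S x) = {restr S x}"
    using orb_self by blast
  then have "orbit_polytope S (restr S x) = {restr S x}"
    by (simp add: orbit_polytope_eq)
  then have "\<exists>p\<in>RI S. orbit_normal_class S x = normal_equiv S `` {{p}}"
    by (intro bexI[of _ "restr S x"]) simp_all
  then show ?thesis
    using True by (simp add: basic_char_def)
next
  case False
  then obtain i j where ij: "i \<in> S" "j \<in> S" "x $ i \<noteq> x $ j"
    unfolding constant_on_def by metis
  let ?O = "orbit_polytope S (restr S x)"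
  have False if p: "orbit_normal_class S x = normal_equiv S `` {{p}}" for p
  proof -
    have "(?O, ?O) \<in> normal_equiv S"
      by (simp add: normal_equiv_iff face_equiv_def orbit_product_orbit_polytope)
    then have "({p}, ?O) \<in> normal_equiv S"
      using p by blast
    then have eq: "face_equiv S {p} ?O"
      by (simp add: normal_equiv_iff)
    \<comment> \<open>Over a point all functionals have the same maximal face. Equivalence carries
      this to \<open>?O\<close>, where \<open>0\<close> has all of \<open>?O\<close> as maximal
      face; so coordinate \<open>i\<close> is constant on \<open>?O\<close>.\<close>
    have "supp_face y {p} = {p}" for y
      by (auto simp: supp_face_def)
    moreover have "0 \<in> RI S" "indic {i} \<in> RI S"
      using ij by (auto simp: RI_def)
    ultimately have "supp_face 0 ?O \<subseteq> supp_face (indic {i}) ?O"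
      "supp_face (indic {i}) ?O \<subseteq> supp_face 0 ?O"
      using eq by (auto simp: face_equiv_def)
    moreover have "supp_face 0 ?O = ?O"
      by (auto simp: supp_face_def)
    ultimately have max: "supp_face (indic {i}) ?O = ?O"
      by simp
    have orb: "orb S (restr S x) \<subseteq> ?O"
      by (simp add: orbit_polytope_eq hull_subset)
    have ind: "indic {i} \<bullet> z = z $ i" for z :: "real ^ 'a"
      using inner_axis[of z i 1] by (simp add: inner_commute indic_def axis_def)
    \<comment> \<open>Swapping two unequal coordinates gives a point of the orbit with another value
      at \<open>i\<close>.\<close>
    let ?z = "\<chi> k. restr S x $ Transposition.transpose i j k"
    have "?z \<in> ?O" "restr S x \<in> ?O"
      using swap_mem_orb[OF _ orb_self ij(1,2), of "restr S x"] orb_self orb by auto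
    then have "indic {i} \<bullet> ?z = indic {i} \<bullet> restr S x"
      using max by (auto simp: supp_face_def intro: order_antisym)
    then show False
      using ij by (simp add: ind)
  qed
  then show ?thesis
    using False by (auto simp: basic_char_def)
qed

subsection \<open>Compositions of points\<close>

lemma comp_of_point_empty [simp]: "comp_of_point {} p = []"
  by (simp add: comp_of_point_def)

lemma comp_of_point_cong:
  assumes "\<And>i. i \<in> I \<Longrightarrow> p $ i = q $ i"
  shows "comp_of_point I p = comp_of_point I q"
proof -
  have "($) p ` I = ($) q ` I" "{i\<in>I. p $ i = v} = {i\<in>I. q $ i = v}" for v
    using assms by auto
  then show ?thesis by (simp add: comp_of_point_def)
qed

text \<open>The recursion for compositions: the top value \<open>v\<close> is last in the ascending
  list of values, hence first after reversal. With \<open>top_level\<close> it supports induction on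
  level sets.\<close>

lemma comp_of_point_split:
  assumes "S \<noteq> {}" "\<And>i. i \<in> S \<Longrightarrow> p $ i = v" "\<And>j. j \<in> J \<Longrightarrow> p $ j < v"
  shows "comp_of_point (S \<union> J) p = card S # comp_of_point J p"
proof -
  have "($) p ` (S \<union> J) = insert v (($) p ` J)"
    using assms(1,2) by (auto simp: image_iff)
  moreover have "v \<notin> ($) p ` J"
    using assms(3) by auto
  moreover have "insort v (sorted_list_of_set (($) p ` J)) = sorted_list_of_set (($) p ` J) @ [v]"
    using assms(3) by (intro sorted_insort_is_snoc) (auto intro: less_imp_le)
  ultimately have list: "sorted_list_of_set (($) p ` (S \<union> J)) = sorted_list_of_set (($) p ` J) @ [v]"
    by simp
  have "{i\<in>S \<union> J. p $ i = v} = S"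
    using assms(2,3) by fastforce
  moreover have "{i\<in>S \<union> J. p $ i = u} = {i\<in>J. p $ i = u}" if "u \<in> ($) p ` J" for u
    using that assms(2,3) by fastforce
  ultimately show ?thesis
    unfolding comp_of_point_def list by simp
qed

lemma top_level:
  fixes p :: "real ^ 'a::finite"
  assumes "I \<noteq> {}"
  obtains S J v where "I = S \<union> J" "S \<inter> J = {}" "S \<noteq> {}"
    "\<And>i. i \<in> S \<Longrightarrow> p $ i = v" "\<And>j. j \<in> J \<Longrightarrow> p $ j < v"
proof -
  define v where "v = Max (($) p ` I)"
  have "v \<in> ($) p ` I"
    unfolding v_def using assms by (intro Max_in) auto
  then have "{i\<in>I. p $ i = v} \<noteq> {}"
    by auto
  moreover have "p $ j < v" if "j \<in> {i\<in>I. p $ i \<noteq> v}" for j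
    using that by (simp add: v_def less_le)
  ultimately show ?thesis
    by (intro that[of "{i\<in>I. p $ i = v}" "{i\<in>I. p $ i \<noteq> v}" v]) auto
qed

text \<open>The top level sets have equal size, so any bijection between them extends one obtained
  below them. Two index sets are allowed because the remainders differ even when
  \<open>I = J\<close>.\<close>

lemma comp_of_point_order_iso:
  fixes p q :: "real ^ 'a::finite"
  assumes "comp_of_point I p = comp_of_point J q"
  shows "\<exists>f. bij_betw f I J \<and> (\<forall>i\<in>I. \<forall>k\<in>I. p $ i \<le> p $ k \<longleftrightarrow> q $ f i \<le> q $ f k)"
  using assms
proof (induction "card I" arbitrary: I J rule: less_induct)
  case less
  show ?case
  proof (cases "I = {} \<or> J = {}")
    case True
    have "I = {} \<and> J = {}"
    proof (rule ccontr)
      assume "\<not> (I = {} \<and> J = {})"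
      then show False
        using less.prems True by (metis top_level comp_of_point_split comp_of_point_empty list.distinct(1))
    qed
    then show ?thesis by (simp add: bij_betw_def)
  next
    case False
    obtain S I' v where I: "I = S \<union> I'" "S \<inter> I' = {}" "S \<noteq> {}"
      "\<And>i. i \<in> S \<Longrightarrow> p $ i = v" "\<And>j. j \<in> I' \<Longrightarrow> p $ j < v"
      using top_level[of I p] False by metis
    obtain T J' w where J: "J = T \<union> J'" "T \<inter> J' = {}" "T \<noteq> {}"
      "\<And>i. i \<in> T \<Longrightarrow> q $ i = w" "\<And>j. j \<in> J' \<Longrightarrow> q $ j < w"
      using top_level[of J q] False by metis
    have card: "card S = card T" and comp: "comp_of_point I' p = comp_of_point J' q"
      using less.prems comp_of_point_split[OF I(3-5)] comp_of_point_split[OF J(3-5)]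
      unfolding I(1) J(1) by simp_all
    have "I' \<subset> I" using I by blast
    then have "card I' < card I" by (simp add: psubset_card_mono)
    then obtain f where f: "bij_betw f I' J'"
      "\<forall>i\<in>I'. \<forall>k\<in>I'. p $ i \<le> p $ k \<longleftrightarrow> q $ f i \<le> q $ f k"
      using less.hyps comp by blast
    obtain g where g: "bij_betw g S T"
      using finite_same_card_bij[OF _ _ card] by auto
    define h where "h i = (if i \<in> S then g i else f i)" for i
    have hS: "h i = g i" if "i \<in> S" for i
      using that by (simp add: h_def)
    have hI: "h i = f i" if "i \<in> I'" for i
      using that I(2) by (auto simp: h_def)
    have "bij_betw h S T" "bij_betw h I' J'"
      using g f(1) bij_betw_cong[of S h g] bij_betw_cong[of I' h f] hS hI by simp_all
    then have "bij_betw h I J"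
      unfolding I(1) J(1) using J(2) by (rule bij_betw_combine)
    moreover have "p $ i \<le> p $ k \<longleftrightarrow> q $ h i \<le> q $ h k" if ik: "i \<in> I" "k \<in> I" for i k
    proof -
      have S: "p $ i = v \<and> q $ h i = w" if "i \<in> S" for i
        using that I(4) J(4) g hS by (auto simp: bij_betw_def)
      have I': "p $ i < v \<and> q $ h i < w" if "i \<in> I'" for i
        using that I(5) J(5) f(1) hI by (auto simp: bij_betw_def)
      consider "i \<in> S" "k \<in> S" | "i \<in> S" "k \<in> I'" | "i \<in> I'" "k \<in> S" | "i \<in> I'" "k \<in> I'"
        using ik I(1) by blast
      then show ?thesis
      proof cases
        case 4
        then show ?thesis using f(2) hI by simp
      qed (use S[of i] S[of k] I'[of i] I'[of k] in auto)
    qed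
    ultimately show ?thesis by blast
  qed
qed

section \<open>Orbit polytopes with the same composition\<close>

lemma supp_face_hull_subset_iff:
  fixes V :: "'b::euclidean_space set"
  assumes "finite V"
  shows "supp_face y0 (convex hull V) \<subseteq> supp_face y (convex hull V) \<longleftrightarrow> supp_face y0 V \<subseteq> supp_face y V"
proof
  have V: "supp_face u V = V \<inter> supp_face u (convex hull V)" for u
  proof
    show "supp_face u V \<subseteq> V \<inter> supp_face u (convex hull V)"
      using assms hull_subset[of "supp_face u V" convex]
      by (simp add: supp_face_convex_hull supp_face_subset)
    show "V \<inter> supp_face u (convex hull V) \<subseteq> supp_face u V"
      using hull_subset[of V convex] by (auto simp: supp_face_def)
  qed
  assume "supp_face y0 (convex hull V) \<subseteq> supp_face y (convex hull V)"
  then show "supp_face y0 V \<subseteq> supp_face y V"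
    unfolding V[of y0] V[of y] by blast
next
  assume "supp_face y0 V \<subseteq> supp_face y V"
  then show "supp_face y0 (convex hull V) \<subseteq> supp_face y (convex hull V)"
    by (simp add: supp_face_convex_hull assms hull_mono)
qed

text \<open>The right-hand side involves \<open>p\<close> only through the order of its coordinates,
  which is why the composition determines the normal fan.\<close>

lemma supp_face_orbit_polytope_subset_iff:
  assumes "p \<in> RI I"
  shows "supp_face y0 (orbit_polytope I p) \<subseteq> supp_face y (orbit_polytope I p) \<longleftrightarrow>
    (\<forall>\<pi>. \<pi> permutes I \<longrightarrow> comonotone I (($) y0) (\<lambda>i. p $ \<pi> i) \<longrightarrow> comonotone I (($) y) (\<lambda>i. p $ \<pi> i))"
proof -
  have act: "($) (perm_act \<sigma> p) = (\<lambda>i. p $ inv \<sigma> i)" for \<sigma>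
    by (simp add: perm_act_def fun_eq_iff)
  have "supp_face y0 (orb I p) \<subseteq> supp_face y (orb I p) \<longleftrightarrow>
    (\<forall>\<sigma>. \<sigma> permutes I \<longrightarrow> comonotone I (($) y0) (\<lambda>i. p $ inv \<sigma> i) \<longrightarrow>
       comonotone I (($) y) (\<lambda>i. p $ inv \<sigma> i))"
    unfolding supp_face_orb[OF assms] subset_iff by (auto simp: orb_def act)
  also have "\<dots> \<longleftrightarrow> (\<forall>\<pi>. \<pi> permutes I \<longrightarrow> comonotone I (($) y0) (\<lambda>i. p $ \<pi> i) \<longrightarrow>
       comonotone I (($) y) (\<lambda>i. p $ \<pi> i))"
    by (metis permutes_inv permutes_inv_inv)
  finally show ?thesis
    by (simp add: orbit_polytope_eq supp_face_hull_subset_iff finite_orb)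
qed

lemma orbit_polytope_normal_equiv:
  assumes p: "p \<in> RI I" and q: "q \<in> RI I" and comp: "comp_of_point I p = comp_of_point I q"
  shows "(orbit_polytope I p, orbit_polytope I q) \<in> normal_equiv I"
proof -
  obtain f where f: "bij_betw f I I" "\<forall>i\<in>I. \<forall>k\<in>I. p $ i \<le> p $ k \<longleftrightarrow> q $ f i \<le> q $ f k"
    using comp_of_point_order_iso[OF comp] by blast
  \<comment> \<open>\<open>r\<close> rearranges \<open>q\<close> so that its coordinates are ordered
    like those of \<open>p\<close>; it has the same orbit polytope as \<open>q\<close>.\<close>
  define r where "r = (\<chi> i. if i \<in> I then q $ f i else 0)"
  have rI: "r \<in> RI I"
    by (simp add: r_def RI_def)
  have "image_mset (($) r) (mset_set I) = image_mset (($) q) (image_mset f (mset_set I))"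
    by (simp add: multiset.map_comp comp_def) (rule image_mset_cong, simp add: r_def)
  also have "image_mset f (mset_set I) = mset_set I"
    using f(1) by (simp add: bij_betw_def image_mset_mset_set)
  finally have "r \<in> orb I q"
    using rI by (simp add: mem_orb_iff[OF q])
  then have Or: "orbit_polytope I r = orbit_polytope I q"
    by (rule orbit_polytope_cong[OF q])
  have "comonotone I y (\<lambda>i. p $ \<pi> i) \<longleftrightarrow> comonotone I y (\<lambda>i. r $ \<pi> i)" if "\<pi> permutes I" for y \<pi>
    using f(2) permutes_in_image[OF that] by (simp add: comonotone_def r_def)
  then have "face_equiv I (orbit_polytope I p) (orbit_polytope I r)"
    by (simp add: face_equiv_def supp_face_orbit_polytope_subset_iff p rI)
  then show ?thesis
    using p q by (simp add: normal_equiv_iff orbit_product_orbit_polytope Or)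
qed

lemma orbit_class_eq:
  assumes "p \<in> RI I"
  shows "orbit_class I (comp_of_point I p) = normal_equiv I `` {orbit_polytope I p}"
proof -
  have "normal_equiv I `` {orbit_polytope I q} = normal_equiv I `` {orbit_polytope I p}"
    if "q \<in> RI I" "comp_of_point I q = comp_of_point I p" for q
    using normal_class_eqI[OF orbit_polytope_normal_equiv[OF that(1) assms that(2)]] .
  then show ?thesis
    using assms unfolding orbit_class_def by blast
qed

lemma exists_point_with_composition:
  assumes "composition_of (card I) \<alpha>"
  shows "\<exists>p\<in>RI I. comp_of_point I p = \<alpha>"
  using assms
proof (induction \<alpha> arbitrary: I)
  case Nil
  then have "I = {}" by (simp add: composition_of_def)
  then show ?case by (auto simp: RI_def intro: exI[of _ 0])
next
  case (Cons a \<alpha>)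
  then have a: "0 < a" "card I = a + sum_list \<alpha>" "\<forall>x\<in>set \<alpha>. 0 < x"
    by (auto simp: composition_of_def)
  then obtain S where S: "S \<subseteq> I" "card S = a"
    using obtain_subset_with_card_n[of a I] by auto
  define J where "J = I - S"
  have "composition_of (card J) \<alpha>"
    using a S by (simp add: composition_of_def J_def card_Diff_subset)
  then obtain p where p: "p \<in> RI J" "comp_of_point J p = \<alpha>"
    using Cons.IH by blast
  \<comment> \<open>The summand \<open>1\<close> puts \<open>v\<close> strictly above all
    coordinates on \<open>J\<close>; the inserted \<open>0\<close> keeps the maximum meaningful when
    \<open>J\<close> is empty.\<close>
  define v where "v = 1 + Max (insert 0 (($) p ` J))"
  have v: "p $ j < v" if "j \<in> J" for j
  proof -
    have "p $ j \<le> Max (insert 0 (($) p ` J))"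
      using that by (intro Max_ge) auto
    then show ?thesis by (simp add: v_def)
  qed
  define q where "q = (\<chi> i. if i \<in> S then v else p $ i)"
  have "S \<noteq> {}" using S a by auto
  then have "comp_of_point (S \<union> J) q = card S # comp_of_point J q"
    using v by (intro comp_of_point_split) (auto simp: q_def J_def)
  also have "comp_of_point J q = \<alpha>"
    using p(2) by (subst comp_of_point_cong[of J q p]) (auto simp: q_def J_def)
  finally have "comp_of_point I q = a # \<alpha>"
    using S by (simp add: J_def Un_absorb1)
  moreover have "q \<in> RI I"
    using p(1) S by (auto simp: RI_def q_def J_def)
  ultimately show ?case by blast
qed

lemma exists_decreasing_rearrangement:
  fixes p :: "real ^ 'a::finite"
  assumes "sorted_wrt disjnt Ss" "\<Union>(set Ss) = I" "p \<in> RI I"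
  obtains x where "x \<in> orb I p" "decreasing_along Ss x"
proof -
  \<comment> \<open>Minus the position of the block containing \<open>i\<close>, so that maximizing
    \<open>y\<close> puts large coordinates into early blocks. \<open>LEAST\<close> finds that
    position, since blocks are disjoint and indices past the end of the list are larger.\<close>
  define y :: "real ^ 'a" where "y = (\<chi> i. - real (LEAST n. i \<in> Ss ! n))"
  obtain x where x: "x \<in> supp_face y (orb I p)"
    using supp_face_nonempty[OF finite_imp_compact[OF finite_orb], of I p y] orb_self by blast
  then have mono: "comonotone I (($) y) (($) x)" "x \<in> orb I p"
    by (auto simp: supp_face_orb[OF assms(3)])
  have "x $ j \<le> x $ i" if mn: "m < n" "n < length Ss" "i \<in> Ss ! m" "j \<in> Ss ! n" for m n i j
  proof -
    have "(LEAST n. i \<in> Ss ! n) \<le> m"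
      using mn by (simp add: Least_le)
    moreover have "m < (LEAST n. j \<in> Ss ! n)"
    proof -
      have "j \<notin> Ss ! k" if "k < n" for k
        using assms(1) that mn by (auto simp: sorted_wrt_iff_nth_less disjnt_def disjoint_iff)
      then have "(LEAST n. j \<in> Ss ! n) = n"
        using mn by (intro Least_equality) (auto simp: not_less[symmetric])
      then show ?thesis using mn by simp
    qed
    ultimately have "y $ j < y $ i"
      by (simp add: y_def)
    moreover have "i \<in> I" "j \<in> I"
      using mn assms(2) by (auto intro!: bexI[of _ "Ss ! m"] bexI[of _ "Ss ! n"])
    ultimately show ?thesis
      using mono(1) by (simp add: comonotone_def)
  qed
  then have "decreasing_along Ss x"
    by (auto simp: decreasing_along_def sorted_wrt_iff_nth_less)
  then show ?thesis
    using that mono(2) by blast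
qed

text \<open>The size of a level set is a multiplicity in the multiset of coordinates.\<close>

lemma comp_of_point_orb:
  assumes "p \<in> RI I" "x \<in> orb I p"
  shows "comp_of_point I x = comp_of_point I p"
proof -
  have eq: "image_mset (($) x) (mset_set I) = image_mset (($) p) (mset_set I)"
    using assms by (simp add: mem_orb_iff)
  have img: "($) x ` I = ($) p ` I"
    using arg_cong[OF eq, of set_mset] by simp
  have "card {i\<in>I. x $ i = v} = count (image_mset (($) x) (mset_set I)) v" for v and x :: "real ^ 'a"
    by (simp add: count_image_mset' Int_def conj_commute eq_commute)
  then show ?thesis
    by (simp add: comp_of_point_def img eq)
qed

section \<open>Refinement and constancy on blocks\<close>

lemma comp_refines_Nil_left: "comp_refines [] \<alpha> \<longleftrightarrow> \<alpha> = []"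
  by (auto simp: comp_refines_def concat_eq_Nil_conv) (metis list.set_intros(1) neq_Nil_conv)

text \<open>Refinement read from the left: \<open>g\<close> either completes the part
  \<open>a\<close> or leaves \<open>a - g\<close> to the later parts. Positivity of these parts
  makes the remainder nonzero in the second case.\<close>

lemma comp_refines_Cons:
  assumes "\<forall>x\<in>set \<gamma>. 0 < x"
  shows "comp_refines (g # \<gamma>) (a # \<alpha>) \<longleftrightarrow>
    g = a \<and> comp_refines \<gamma> \<alpha> \<or> g < a \<and> comp_refines \<gamma> ((a - g) # \<alpha>)"
proof
  assume "comp_refines (g # \<gamma>) (a # \<alpha>)"
  then obtain cs where cs: "[] \<notin> set cs" "map sum_list cs = a # \<alpha>" "concat cs = g # \<gamma>"
    unfolding comp_refines_def by (elim exE conjE) (rule that)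
  then obtain b bs where "cs = b # bs"
    by (cases cs) auto
  with cs have b: "b \<noteq> []" "[] \<notin> set bs" "sum_list b = a" "map sum_list bs = \<alpha>"
    "b @ concat bs = g # \<gamma>"
    by auto
  then obtain b' where b': "b = g # b'" "b' @ concat bs = \<gamma>"
    by (auto simp: append_eq_Cons_conv)
  show "g = a \<and> comp_refines \<gamma> \<alpha> \<or> g < a \<and> comp_refines \<gamma> ((a - g) # \<alpha>)"
  proof (cases "b' = []")
    case True
    then show ?thesis using b b' by (auto simp: comp_refines_def)
  next
    case False
    then have "0 < sum_list b'"
      using assms b'(2) by (cases b') auto
    moreover have "comp_refines \<gamma> ((a - g) # \<alpha>)"
      unfolding comp_refines_def using False b b' by (intro exI[of _ "b' # bs"]) auto
    ultimately show ?thesis using b b' by auto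
  qed
next
  assume "g = a \<and> comp_refines \<gamma> \<alpha> \<or> g < a \<and> comp_refines \<gamma> ((a - g) # \<alpha>)"
  then show "comp_refines (g # \<gamma>) (a # \<alpha>)"
  proof
    assume "g = a \<and> comp_refines \<gamma> \<alpha>"
    then obtain bs where "[] \<notin> set bs" "map sum_list bs = \<alpha>" "concat bs = \<gamma>" "g = a"
      by (auto simp: comp_refines_def)
    then show ?thesis
      unfolding comp_refines_def by (intro exI[of _ "[g] # bs"]) auto
  next
    assume "g < a \<and> comp_refines \<gamma> ((a - g) # \<alpha>)"
    then obtain b bs where "[] \<notin> set bs" "sum_list b = a - g" "map sum_list bs = \<alpha>"
      "b @ concat bs = \<gamma>" "g < a"
      by (auto simp: comp_refines_def map_eq_Cons_conv)
    then show ?thesis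
      unfolding comp_refines_def by (intro exI[of _ "(g # b) # bs"]) auto
  qed
qed

text \<open>The first block holds the largest values. If \<open>x\<close> is constant on it, it is
  the whole top level or a proper piece of it, matching the two cases of
  \<open>comp_refines_Cons\<close>; otherwise the top level is too small to contain it.\<close>

lemma constant_on_blocks_iff_refines:
  fixes x :: "real ^ 'a::finite"
  assumes "sorted_wrt disjnt Ss" "{} \<notin> set Ss" "decreasing_along Ss x"
  shows "(\<forall>S\<in>set Ss. (($) x) constant_on S) \<longleftrightarrow>
    comp_refines (map card Ss) (comp_of_point (\<Union>(set Ss)) x)"
  using assms
proof (induction Ss)
  case Nil
  then show ?case by (simp add: comp_refines_Nil_left)
next
  case (Cons S Ss)
  define J where "J = \<Union>(set Ss)"
  have IH: "(\<forall>S\<in>set Ss. (($) x) constant_on S) \<longleftrightarrow> comp_refines (map card Ss) (comp_of_point J x)"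
    unfolding J_def using Cons.prems by (intro Cons.IH) (auto simp: decreasing_along_def)
  have disj: "S \<inter> J = {}"
    using Cons.prems by (auto simp: J_def disjnt_def)
  have le: "x $ j \<le> x $ i" if "i \<in> S" "j \<in> J" for i j
    using Cons.prems that by (auto simp: decreasing_along_def J_def)
  have "S \<noteq> {}" using Cons.prems by auto
  have pos: "\<forall>n\<in>set (map card Ss). 0 < n"
    using Cons.prems by (auto simp: card_gt_0_iff)
  show ?case
  proof (cases "(($) x) constant_on S")
    case True
    then obtain v where v: "\<And>i. i \<in> S \<Longrightarrow> x $ i = v"
      by (auto simp: constant_on_def)
    \<comment> \<open>The points of later blocks that share the value of the first block; the top
      level of \<open>S \<union> J\<close> is \<open>S \<union> T\<close>.\<close>
    define T where "T = {j\<in>J. x $ j = v}"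
    have J: "J = T \<union> (J - T)"
      by (auto simp: T_def)
    have lt: "x $ j < v" if "j \<in> J - T" for j
      using that le \<open>S \<noteq> {}\<close> v by (force simp: T_def less_le)
    have "comp_refines (card S # map card Ss) (comp_of_point (S \<union> J) x) \<longleftrightarrow>
      comp_refines (map card Ss) (comp_of_point J x)"
    proof (cases "T = {}")
      case True
      then have "comp_of_point (S \<union> J) x = card S # comp_of_point J x"
        using v lt \<open>S \<noteq> {}\<close> by (intro comp_of_point_split) auto
      then show ?thesis
        using pos by (simp add: comp_refines_Cons)
    next
      case False
      have "comp_of_point (T \<union> (J - T)) x = card T # comp_of_point (J - T) x"
        using lt False by (intro comp_of_point_split[where v = v]) (auto simp: T_def)
      moreover have "comp_of_point ((S \<union> T) \<union> (J - T)) x = card (S \<union> T) # comp_of_point (J - T) x"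
        using v lt False by (intro comp_of_point_split[where v = v]) (auto simp: T_def)
      moreover have "(S \<union> T) \<union> (J - T) = S \<union> J" "T \<union> (J - T) = J"
        using J by auto
      moreover have "card (S \<union> T) = card S + card T"
        using disj by (intro card_Un_disjoint) (auto simp: T_def)
      moreover have "0 < card T"
        using False by (simp add: card_gt_0_iff)
      ultimately show ?thesis
        using pos False by (simp add: comp_refines_Cons)
    qed
    then show ?thesis
      using IH True by (simp add: J_def)
  next
    case False
    obtain T J' v where T: "S = T \<union> J'" "T \<inter> J' = {}" "T \<noteq> {}"
      "\<And>i. i \<in> T \<Longrightarrow> x $ i = v" "\<And>j. j \<in> J' \<Longrightarrow> x $ j < v"
      using top_level[OF \<open>S \<noteq> {}\<close>] by metis
    have "J' \<noteq> {}"
      using False T by (auto simp: constant_on_def)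
    then obtain k where k: "k \<in> J'" by blast
    \<comment> \<open>Coordinates on \<open>J\<close> are at most the one at \<open>k\<close>, which
      is already below \<open>v\<close>; hence the top level of \<open>S \<union> J\<close> is
      \<open>T\<close>, a proper subset of \<open>S\<close>.\<close>
    have "x $ j < v" if "j \<in> J' \<union> J" for j
      using that T(1) T(5)[of j] T(5)[OF k] le[of k j] k by auto
    then have "comp_of_point (T \<union> (J' \<union> J)) x = card T # comp_of_point (J' \<union> J) x"
      using T(3,4) by (intro comp_of_point_split) auto
    moreover have "card T < card S"
      using T k by (intro psubset_card_mono) auto
    moreover have "S \<union> J = T \<union> (J' \<union> J)"
      using T(1) by blast
    ultimately have "\<not> comp_refines (card S # map card Ss) (comp_of_point (S \<union> J) x)"
      using pos by (simp add: comp_refines_Cons)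
    then show ?thesis
      using False by (simp add: J_def)
  qed
qed

subsection \<open>Counting ordered partitions\<close>

lemma ordered_partition_Nil: "ordered_partition I [] \<longleftrightarrow> I = {}"
  by (auto simp: ordered_partition_def partition_on_def)

text \<open>Disjointness by positions passes to tails of the list and so suits induction. Nonempty
  blocks that are disjoint at different positions cannot repeat.\<close>

lemma ordered_partition_iff:
  "ordered_partition I Ss \<longleftrightarrow> sorted_wrt disjnt Ss \<and> {} \<notin> set Ss \<and> \<Union>(set Ss) = I"
proof
  assume "ordered_partition I Ss"
  then have Ss: "distinct Ss" "disjoint (set Ss)" "{} \<notin> set Ss" "\<Union>(set Ss) = I"
    by (auto simp: ordered_partition_def partition_on_def)
  have "sorted_wrt disjnt Ss"
    unfolding sorted_wrt_iff_nth_less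
  proof (intro allI impI)
    fix i j assume ij: "i < j" "j < length Ss"
    then have "Ss ! i \<noteq> Ss ! j"
      using Ss(1) by (simp add: nth_eq_iff_index_eq)
    then show "disjnt (Ss ! i) (Ss ! j)"
      using Ss(2) ij by (intro pairwiseD[OF Ss(2)]) auto
  qed
  then show "sorted_wrt disjnt Ss \<and> {} \<notin> set Ss \<and> \<Union>(set Ss) = I"
    using Ss by simp
next
  assume *: "sorted_wrt disjnt Ss \<and> {} \<notin> set Ss \<and> \<Union>(set Ss) = I"
  then have "distinct Ss \<and> disjoint (set Ss)"
  proof (induction Ss arbitrary: I)
    case (Cons S Ss)
    then have "distinct Ss \<and> disjoint (set Ss)"
      by simp
    moreover have "S \<notin> set Ss"
      using Cons.prems by (auto simp: disjnt_def)
    ultimately show ?case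
      using Cons.prems by (auto simp: pairwise_insert disjnt_sym)
  qed simp
  then show "ordered_partition I Ss"
    using * by (simp add: ordered_partition_def partition_on_def)
qed

lemma ordered_partition_Cons:
  "ordered_partition I (S # Ss) \<longleftrightarrow> S \<noteq> {} \<and> S \<subseteq> I \<and> ordered_partition (I - S) Ss"
  by (auto simp: ordered_partition_iff disjnt_def)

lemma finite_ordered_partitions: "finite {Ss. ordered_partition (I :: 'a::finite set) Ss}"
proof (rule finite_subset)
  show "{Ss. ordered_partition I Ss} \<subseteq> {Ss. set Ss \<subseteq> UNIV \<and> distinct Ss}"
    by (auto simp: ordered_partition_def)
qed (rule finite_subset_distinct, simp)

lemma composition_of_block_sizes:
  fixes I :: "'a::finite set"
  assumes "ordered_partition I Ss"
  shows "composition_of (card I) (map card Ss)"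
  using assms
proof (induction Ss arbitrary: I)
  case Nil
  then show ?case by (simp add: ordered_partition_Nil composition_of_def)
next
  case (Cons S Ss)
  then have "composition_of (card (I - S)) (map card Ss)" "S \<noteq> {}" "S \<subseteq> I"
    by (auto simp: ordered_partition_Cons)
  then show ?case
    by (simp add: composition_of_def card_Diff_subset card_gt_0_iff card_mono)
qed

lemma length_le_composition: "composition_of n \<gamma> \<Longrightarrow> length \<gamma> \<le> n"
proof (induction \<gamma> arbitrary: n)
  case (Cons g \<gamma>)
  then show ?case
    using Cons.IH[of "n - g"] by (auto simp: composition_of_def)
qed simp

text \<open>Choose the first block among the \<open>g\<close>-subsets, then partition the rest. The
  multiplied form avoids division during the induction and shows that the \<open>div\<close> in
  \<open>multinomial\<close> is exact.\<close>

lemma card_ordered_partitions_times_fact: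
  fixes I :: "'a::finite set"
  assumes "composition_of (card I) \<gamma>"
  shows "card {Ss. ordered_partition I Ss \<and> map card Ss = \<gamma>} * (\<Prod>x\<leftarrow>\<gamma>. fact x) = fact (card I)"
  using assms
proof (induction \<gamma> arbitrary: I)
  case Nil
  then have "I = {}"
    by (simp add: composition_of_def)
  then have "{Ss. ordered_partition I Ss \<and> map card Ss = []} = {[]}"
    by (auto simp: ordered_partition_Nil)
  then show ?case using \<open>I = {}\<close> by simp
next
  case (Cons g \<gamma>)
  have g: "0 < g" "card I = g + sum_list \<gamma>" "\<forall>x\<in>set \<gamma>. 0 < x"
    using Cons.prems by (auto simp: composition_of_def)
  define A where "A J = {Ss. ordered_partition J Ss \<and> map card Ss = \<gamma>}" for J :: "'a set"
  define B where "B = {S. S \<subseteq> I \<and> card S = g}"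
  have A: "card (A (I - S)) * (\<Prod>x\<leftarrow>\<gamma>. fact x) = fact (card I - g)" if "S \<in> B" for S
  proof -
    have "card (I - S) = card I - g"
      using that by (simp add: B_def card_Diff_subset)
    moreover from this have "composition_of (card (I - S)) \<gamma>"
      using g by (simp add: composition_of_def)
    ultimately show ?thesis
      using Cons.IH[of "I - S"] by (simp add: A_def)
  qed
  have "{Ss. ordered_partition I Ss \<and> map card Ss = g # \<gamma>} =
    (\<lambda>(S, Ss). S # Ss) ` (SIGMA S:B. A (I - S))"
    using g(1) by (force simp: A_def B_def ordered_partition_Cons map_eq_Cons_conv)
  moreover have "inj_on (\<lambda>(S, Ss). S # Ss) (SIGMA S:B. A (I - S))"
    by (auto simp: inj_on_def)
  moreover have "finite (A J)" for J
    unfolding A_def by (rule finite_subset[OF _ finite_ordered_partitions[of J]]) auto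
  ultimately have "card {Ss. ordered_partition I Ss \<and> map card Ss = g # \<gamma>} = (\<Sum>S\<in>B. card (A (I - S)))"
    by (simp add: card_image)
  then have "card {Ss. ordered_partition I Ss \<and> map card Ss = g # \<gamma>} * (\<Prod>x\<leftarrow>\<gamma>. fact x) =
      (\<Sum>S\<in>B. card (A (I - S)) * (\<Prod>x\<leftarrow>\<gamma>. fact x))"
    by (simp add: sum_distrib_right)
  also have "\<dots> = card B * fact (card I - g)"
    using A by simp
  also have "card B = card I choose g"
    unfolding B_def by (rule n_subsets) simp
  finally show ?case
    using binomial_fact_lemma[of g "card I"] g(2) by (simp add: mult_ac)
qed

lemma card_ordered_partitions:
  fixes I :: "'a::finite set"
  assumes "composition_of (card I) \<gamma>"
  shows "card {Ss. ordered_partition I Ss \<and> map card Ss = \<gamma>} = multinomial (card I) \<gamma>"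
proof -
  have "(\<Prod>x\<leftarrow>\<gamma>. fact x :: nat) \<noteq> 0"
    by (induction \<gamma>) auto
  then show ?thesis
    unfolding multinomial_def card_ordered_partitions_times_fact[OF assms, symmetric] by simp
qed

section \<open>Evaluating and summing the contributions of ordered partitions\<close>

text \<open>The class is represented by a rearrangement \<open>x\<close> decreasing along
  \<open>Ss\<close>, so the product of characters tests whether \<open>x\<close> is constant on
  every block.\<close>

lemma basic_char_iter_coproduct:
  fixes I :: "'a::finite set"
  assumes "composition_of (card I) \<alpha>" "ordered_partition I Ss"
  shows "prod_list (map2 basic_char Ss (iter_coproduct Ss (orbit_class I \<alpha>))) =
    (if comp_refines (map card Ss) \<alpha> then 1 else 0 :: 'k::field)"
proof -
  obtain p where p: "p \<in> RI I" "comp_of_point I p = \<alpha>"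
    using exists_point_with_composition[OF assms(1)] by blast
  have Ss: "sorted_wrt disjnt Ss" "{} \<notin> set Ss" "\<Union>(set Ss) = I"
    using assms(2) by (simp_all add: ordered_partition_iff)
  obtain x where x: "x \<in> orb I p" "decreasing_along Ss x"
    using exists_decreasing_rearrangement[OF Ss(1,3) p(1)] .
  have xI: "x \<in> RI I"
    using x(1) orb_subset_RI[OF p(1)] by blast
  have comp: "comp_of_point I x = \<alpha>"
    using comp_of_point_orb[OF p(1) x(1)] p(2) by simp
  have "iter_coproduct Ss (orbit_class I \<alpha>) = map (\<lambda>S. orbit_normal_class S x) Ss"
    using iter_coproduct_orbit_class[OF Ss(1) x(2)] orbit_class_eq[OF xI] xI
    by (simp add: comp Ss(3) restr_id)
  then have "prod_list (map2 basic_char Ss (iter_coproduct Ss (orbit_class I \<alpha>))) =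
      (\<Prod>S\<leftarrow>Ss. basic_char S (orbit_normal_class S x) :: 'k)"
    by (simp add: map2_map_map zip_map2 zip_same_conv_map comp_def)
  also have "\<dots> = (if \<forall>S\<in>set Ss. (($) x) constant_on S then 1 else 0)"
    unfolding basic_char_orbit_class by (induction Ss) auto
  also have "\<dots> = (if comp_refines (map card Ss) \<alpha> then 1 else 0)"
    using constant_on_blocks_iff_refines[OF Ss(1,2) x(2)] by (simp add: Ss(3) comp)
  finally show ?thesis .
qed

theorem proposition5p8:
  fixes I :: "'a::finite set" and \<alpha> :: "nat list"
  assumes "I \<noteq> {}" and "composition_of (card I) \<alpha>"
  shows "(poly_invariant I (orbit_class I \<alpha>) :: 'k::field_char_0 poly) =
    (\<Sum>\<gamma> | composition_of (card I) \<gamma> \<and> comp_refines \<gamma> \<alpha>.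
       of_nat (multinomial (card I) \<gamma>) * binomial_poly (length \<gamma>))"
proof -
  define OI where "OI = {Ss. ordered_partition I Ss}"
  define R where "R = {Ss\<in>OI. comp_refines (map card Ss) \<alpha>}"
  define G where "G = {\<gamma>. composition_of (card I) \<gamma> \<and> comp_refines \<gamma> \<alpha>}"
  define b :: "nat \<Rightarrow> 'k poly" where "b = binomial_poly"
  have fin: "finite OI" "finite R"
    by (simp_all add: OI_def R_def finite_ordered_partitions)
  have fibre: "{Ss\<in>R. map card Ss = \<gamma>} = {Ss. ordered_partition I Ss \<and> map card Ss = \<gamma>}"
    if "\<gamma> \<in> G" for \<gamma>
    using that by (auto simp: R_def OI_def G_def)
  \<comment> \<open>Gives finiteness of \<open>G\<close>: every fibre is nonempty, because its size
    times a product is a factorial.\<close>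
  have "G \<subseteq> map card ` R"
  proof
    fix \<gamma> assume \<gamma>: "\<gamma> \<in> G"
    then have "card {Ss\<in>R. map card Ss = \<gamma>} \<noteq> 0"
      using card_ordered_partitions_times_fact[of I \<gamma>] fibre[OF \<gamma>]
      by (metis (no_types, lifting) G_def fact_nonzero mem_Collect_eq mult_0)
    then show "\<gamma> \<in> map card ` R"
      by (auto simp: card_eq_0_iff)
  qed
  then have finG: "finite G"
    using fin(2) finite_surj by blast
  have R_G: "map card ` R \<subseteq> G"
    using composition_of_block_sizes by (auto simp: R_def OI_def G_def)
  \<comment> \<open>The lower bound \<open>1\<close> comes from \<open>I \<noteq> {}\<close>, which
    excludes the empty list; hence the sum over \<open>k\<close> misses no ordered
    partition.\<close>
  have length: "length ` OI \<subseteq> {1..card I}"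
  proof -
    have "1 \<le> length Ss \<and> length Ss \<le> card I" if "Ss \<in> OI" for Ss
      using that assms(1) length_le_composition[OF composition_of_block_sizes[of I Ss]]
      by (cases Ss) (auto simp: OI_def ordered_partition_Nil)
    then show ?thesis by auto
  qed
  have "poly_invariant I (orbit_class I \<alpha>) =
      (\<Sum>k=1..card I. smult (\<Sum>Ss | Ss \<in> OI \<and> length Ss = k. if comp_refines (map card Ss) \<alpha> then 1 else 0) (b k))"
    unfolding poly_invariant_def b_def OI_def
    by (intro sum.cong refl arg_cong2[where f = smult])
      (auto simp: basic_char_iter_coproduct[OF assms(2)])
  \<comment> \<open>With \<open>k\<close> replaced by \<open>length Ss\<close> inside the sum, the
    grouping by length can be undone.\<close>
  also have "\<dots> = (\<Sum>k=1..card I. \<Sum>Ss | Ss \<in> OI \<and> length Ss = k.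
      if comp_refines (map card Ss) \<alpha> then b (length Ss) else 0)"
    by (intro sum.cong refl) (auto simp: smult_sum intro!: sum.cong)
  also have "\<dots> = (\<Sum>Ss\<in>OI. if comp_refines (map card Ss) \<alpha> then b (length Ss) else 0)"
    using fin(1) length by (intro sum.group) auto
  also have "\<dots> = (\<Sum>Ss\<in>R. b (length Ss))"
    unfolding R_def using fin(1) by (simp add: sum.inter_filter)
  \<comment> \<open>Regroup by block sizes; the summand is constant on each fibre, whose size is the
    multinomial coefficient.\<close>
  also have "\<dots> = (\<Sum>\<gamma>\<in>G. \<Sum>Ss | Ss \<in> R \<and> map card Ss = \<gamma>. b (length Ss))"
    using fin(2) finG R_G by (intro sum.group[symmetric]) auto
  also have "\<dots> = (\<Sum>\<gamma>\<in>G. of_nat (multinomial (card I) \<gamma>) * b (length \<gamma>))"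
  proof (intro sum.cong refl)
    fix \<gamma> assume \<gamma>: "\<gamma> \<in> G"
    have "(\<Sum>Ss | Ss \<in> R \<and> map card Ss = \<gamma>. b (length Ss)) = (\<Sum>Ss | Ss \<in> R \<and> map card Ss = \<gamma>. b (length \<gamma>))"
      by (intro sum.cong refl) auto
    also have "\<dots> = of_nat (card {Ss\<in>R. map card Ss = \<gamma>}) * b (length \<gamma>)"
      by simp
    finally show "(\<Sum>Ss | Ss \<in> R \<and> map card Ss = \<gamma>. b (length Ss)) = of_nat (multinomial (card I) \<gamma>) * b (length \<gamma>)"
      using \<gamma> card_ordered_partitions[of I \<gamma>] by (simp add: fibre G_def)
  qed
  finally show ?thesis
    by (simp add: G_def b_def)
qed

end
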